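(* Let $P,P'$ be irreducible $\mathcal{K}_n$-modules and let $V,V'$ be irreducible $\mathfrak{sl}_n$-modules. Suppose that $V\not\cong V(\delta_k)$ for all $k=0,1,\dots,n-1$. Then the two $\mathbb{S}_n$-modules $\mathcal{F}(P,V)$ and $\mathcal{F}(P',V')$ are isomorphic if and only if $P\cong P'$ (as $\mathcal{K}_n$-modules) and $V\cong V'$ (as $\mathfrak{sl}_n$-modules).
   Context: All algebras and vector spaces are over $\mathbb{C}$, and $n\ge 2$ is a fixed integer. Let $A_n=\mathbb{C}[x_1^{\pm1},\dots,x_n^{\pm1}]$, $\partial_i=x_i\frac{\partial}{\partial x_i}$, and $x^r=x_1^{r_1}\cdots x_n^{r_n}$ for $r=(r_1,\dots,r_n)^T\in\mathbb{Z}^n$. Let $\mathcal{K}_n$ be the Weyl algebra over $A_n$, i.e. the (unital associative) algebra of differential operators on $A_n$ generated by $A_n$ and $\partial_1,\dots,\partial_n$. Elements of $\mathbb{C}^n$ and $\mathbb{Z}^n$ are column vectors and $(u|v)=u^Tv$. For $u=(u_1,\dots,u_n)^T\in\mathbb{C}^n$ and $r\in\mathbb{Z}^n$ put $D(u,r)=x^r\sum_{i=1}^n u_i\partial_i$; these span the Witt algebra $W_n=\mathrm{Der}(A_n)$, with $[D(u,r),D(v,s)]=D(w,r+s)$, $w=(u|s)v-(v|r)u$. The Lie algebra of divergence zero vector fields on an $n$-dimensional torus is the Lie subalgebra $$\mathbb{S}_n=\mathrm{span}\{D(u,r)\mid u\in\mathbb{C}^n,\ r\in\mathbb{Z}^n,\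 (u|r)=0\}\subseteq W_n .$$ For an $\mathfrak{sl}_n$-module $V$ and a $\mathcal{K}_n$-module $P$, let $\mathcal{F}(P,V)=P\otimes V$ with the $\mathbb{S}_n$-action $$D(u,r)(z\otimes y)=D(u,r)z\otimes y+x^rz\otimes (ru^T)y,\qquad z\in P,\ y\in V,\ (u|r)=0,$$ where $D(u,r)\in\mathcal{K}_n$ acts on $P$, and $ru^T$ is an $n\times n$ matrix which lies in $\mathfrak{sl}_n$ because $(u|r)=0$. $V(\delta_k)$ denotes the simple finite-dimensional $\mathfrak{sl}_n$-module whose highest weight is the fundamental weight $\delta_k$ ($\delta_k(h_j)=\delta_{k,j}$ for $h_j=E_{jj}-E_{j+1,j+1}$, $1\le j\le n-1$), with $\delta_0=0$; equivalently $V(\delta_k)\cong\bigwedge^k(\mathbb{C}^n)$, with $V(\delta_0)$ the trivial one-dimensional module. *)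

theory Defs
  imports
    "HOL-Analysis.Analysis"
    "HOL-Library.Poly_Mapping"
    "HOL-Library.Function_Algebras"
begin

section \<open>Complex vector spaces\<close>

class complex_vector = ab_group_add +
  fixes scaleC :: "complex \<Rightarrow> 'a \<Rightarrow> 'a"  (infixr \<open>*\<^sub>C\<close> 75)
  assumes scaleC_add_right: "c *\<^sub>C (x + y) = c *\<^sub>C x + c *\<^sub>C y"
    and scaleC_add_left: "(c + d) *\<^sub>C x = c *\<^sub>C x + d *\<^sub>C x"
    and scaleC_scaleC: "c *\<^sub>C (d *\<^sub>C x) = (c * d) *\<^sub>C x"
    and scaleC_one: "1 *\<^sub>C x = x"

global_interpretation complex_vector:
  vector_space "scaleC :: complex \<Rightarrow> 'a \<Rightarrow> 'a::complex_vector"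
  by standard (simp_all add: scaleC_add_right scaleC_add_left scaleC_scaleC scaleC_one)

abbreviation clinear :: "('a::complex_vector \<Rightarrow> 'b::complex_vector) \<Rightarrow> bool"
  where "clinear \<equiv> Vector_Spaces.linear scaleC scaleC"

lemma clinearI:
  assumes "\<And>x y. f (x + y) = f x + f y" "\<And>c x. f (c *\<^sub>C x) = c *\<^sub>C f x"
  shows "clinear f"
  by (simp add: Vector_Spaces.linear_def complex_vector.vector_space_axioms module_hom_def
      module_hom_axioms_def complex_vector.module_axioms assms)

lemma clinear_add: "clinear f \<Longrightarrow> f (x + y) = f x + f y"
  and clinear_scaleC: "clinear f \<Longrightarrow> f (c *\<^sub>C x) = c *\<^sub>C f x"
  by (simp_all add: Vector_Spaces.linear_def module_hom_def module_hom_axioms_def)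

instantiation complex :: complex_vector
begin
definition scaleC_complex :: "complex \<Rightarrow> complex \<Rightarrow> complex"
  where "scaleC_complex = (*)"
instance by standard (simp_all add: scaleC_complex_def algebra_simps)
end

instantiation vec :: (complex_vector, finite) complex_vector
begin
definition scaleC_vec :: "complex \<Rightarrow> 'a ^ 'b \<Rightarrow> 'a ^ 'b"
  where "scaleC_vec c x = (\<chi> i. c *\<^sub>C x $ i)"
instance
  by standard (simp_all add: scaleC_vec_def vec_eq_iff scaleC_add_right scaleC_add_left
      scaleC_scaleC scaleC_one)
end

instantiation "fun" :: (type, complex_vector) complex_vector
begin
definition scaleC_fun :: "complex \<Rightarrow> ('a \<Rightarrow> 'b) \<Rightarrow> 'a \<Rightarrow> 'b"
  where "scaleC_fun c f = (\<lambda>x. c *\<^sub>C f x)"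
instance
  by standard (simp_all add: scaleC_fun_def fun_eq_iff scaleC_add_right scaleC_add_left
      scaleC_scaleC scaleC_one)
end

instantiation poly_mapping :: (type, complex_vector) complex_vector
begin
definition scaleC_poly_mapping :: "complex \<Rightarrow> ('a \<Rightarrow>\<^sub>0 'b) \<Rightarrow> 'a \<Rightarrow>\<^sub>0 'b"
  where "scaleC_poly_mapping c = Poly_Mapping.map (scaleC c)"

lemma lookup_scaleC: "Poly_Mapping.lookup (c *\<^sub>C f) k = c *\<^sub>C Poly_Mapping.lookup f k"
  by (simp add: scaleC_poly_mapping_def Poly_Mapping.map.rep_eq when_def)

instance
  by standard (rule poly_mapping_eqI,
      simp add: lookup_scaleC lookup_add scaleC_add_right scaleC_add_left
      scaleC_scaleC scaleC_one)+
end

section \<open>Tensor products\<close>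

text \<open>
  The tensor product over \<open>\<complex>\<close> is the free complex vector space on \<open>'p \<times> 'v\<close> modulo the subspace
  spanned by the bilinearity relators.
\<close>

definition tensor_relators :: "(('p::complex_vector \<times> 'v::complex_vector) \<Rightarrow>\<^sub>0 complex) set"
  where "tensor_relators =
      {Poly_Mapping.single (z + z', y) 1 - Poly_Mapping.single (z, y) 1
         - Poly_Mapping.single (z', y) 1 | z z' y. True}
    \<union> {Poly_Mapping.single (z, y + y') 1 - Poly_Mapping.single (z, y) 1
         - Poly_Mapping.single (z, y') 1 | z y y'. True}
    \<union> {Poly_Mapping.single (c *\<^sub>C z, y) 1 - c *\<^sub>C Poly_Mapping.single (z, y) 1 | c z y. True}
    \<union> {Poly_Mapping.single (z, c *\<^sub>C y) 1 - c *\<^sub>C Poly_Mapping.single (z, y) 1 | c z y. True}"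

definition tensor_rel ::
  "(('p::complex_vector \<times> 'v::complex_vector) \<Rightarrow>\<^sub>0 complex) \<Rightarrow> (('p \<times> 'v) \<Rightarrow>\<^sub>0 complex) \<Rightarrow> bool"
  where "tensor_rel s t \<longleftrightarrow> s - t \<in> complex_vector.span tensor_relators"

quotient_type (overloaded) ('p, 'v) tensor =
  "('p::complex_vector \<times> 'v::complex_vector) \<Rightarrow>\<^sub>0 complex" / tensor_rel
proof (rule equivpI)
  show "reflp tensor_rel"
    by (auto intro!: reflpI simp: tensor_rel_def complex_vector.span_zero)
  show "symp tensor_rel"
    using complex_vector.span_neg by (fastforce intro!: sympI simp: tensor_rel_def)
  show "transp tensor_rel"
  proof (rule transpI)
    fix a b c
    assume "tensor_rel a b" "tensor_rel b c"
    then show "tensor_rel a c"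
      using complex_vector.span_add[of "a - b" tensor_relators "b - c"] by (simp add: tensor_rel_def)
  qed
qed

instantiation tensor :: (complex_vector, complex_vector) complex_vector
begin

lift_definition zero_tensor :: "('a, 'b) tensor" is 0 .

lift_definition plus_tensor :: "('a, 'b) tensor \<Rightarrow> ('a, 'b) tensor \<Rightarrow> ('a, 'b) tensor" is "(+)"
  unfolding tensor_rel_def
proof -
  fix a b c d :: "('a \<times> 'b) \<Rightarrow>\<^sub>0 complex"
  assume "a - b \<in> complex_vector.span tensor_relators" "c - d \<in> complex_vector.span tensor_relators"
  then have "(a - b) + (c - d) \<in> complex_vector.span tensor_relators"
    by (rule complex_vector.span_add)
  then show "a + c - (b + d) \<in> complex_vector.span tensor_relators" by (simp add: add_diff_add)
qed

lift_definition uminus_tensor :: "('a, 'b) tensor \<Rightarrow> ('a, 'b) tensor" is uminus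
  unfolding tensor_rel_def
proof -
  fix a b :: "('a \<times> 'b) \<Rightarrow>\<^sub>0 complex"
  assume "a - b \<in> complex_vector.span tensor_relators"
  then have "- (a - b) \<in> complex_vector.span tensor_relators"
    by (rule complex_vector.span_neg)
  then show "- a - - b \<in> complex_vector.span tensor_relators" by simp
qed

lift_definition minus_tensor :: "('a, 'b) tensor \<Rightarrow> ('a, 'b) tensor \<Rightarrow> ('a, 'b) tensor" is "(-)"
  unfolding tensor_rel_def
proof -
  fix a b c d :: "('a \<times> 'b) \<Rightarrow>\<^sub>0 complex"
  assume "a - b \<in> complex_vector.span tensor_relators" "c - d \<in> complex_vector.span tensor_relators"
  then have "(a - b) - (c - d) \<in> complex_vector.span tensor_relators"
    by (rule complex_vector.span_diff)
  moreover have "(a - b) - (c - d) = a - c - (b - d)" by simp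
  ultimately show "a - c - (b - d) \<in> complex_vector.span tensor_relators" by simp
qed

lift_definition scaleC_tensor :: "complex \<Rightarrow> ('a, 'b) tensor \<Rightarrow> ('a, 'b) tensor" is scaleC
  unfolding tensor_rel_def
  by (simp add: complex_vector.span_scale flip: complex_vector.scale_right_diff_distrib)

lemma tensor_rel_refl: "tensor_rel s s"
  by (simp add: tensor_rel_def complex_vector.span_zero)

instance
  by standard
    (transfer, simp add: tensor_rel_refl algebra_simps scaleC_add_right scaleC_add_left
      scaleC_scaleC scaleC_one)+

end

lift_definition pure_tensor :: "'p::complex_vector \<Rightarrow> 'v::complex_vector \<Rightarrow> ('p, 'v) tensor"
    (infixl \<open>\<otimes>\<^sub>C\<close> 70)
  is "\<lambda>z y. Poly_Mapping.single (z, y) 1" .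

lemma pure_tensor_add_left: "(z + z') \<otimes>\<^sub>C y = z \<otimes>\<^sub>C y + z' \<otimes>\<^sub>C y"
  by transfer (unfold tensor_rel_def diff_diff_eq[symmetric], rule complex_vector.span_base,
      unfold tensor_relators_def, blast)

lemma pure_tensor_add_right: "z \<otimes>\<^sub>C (y + y') = z \<otimes>\<^sub>C y + z \<otimes>\<^sub>C y'"
  by transfer (unfold tensor_rel_def diff_diff_eq[symmetric], rule complex_vector.span_base,
      unfold tensor_relators_def, blast)

lemma pure_tensor_scaleC_left: "(c *\<^sub>C z) \<otimes>\<^sub>C y = c *\<^sub>C (z \<otimes>\<^sub>C y)"
  by transfer (unfold tensor_rel_def diff_diff_eq[symmetric], rule complex_vector.span_base,
      unfold tensor_relators_def, blast)

lemma pure_tensor_scaleC_right: "z \<otimes>\<^sub>C (c *\<^sub>C y) = c *\<^sub>C (z \<otimes>\<^sub>C y)"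
  by transfer (unfold tensor_rel_def diff_diff_eq[symmetric], rule complex_vector.span_base,
      unfold tensor_relators_def, blast)

definition cbilinear :: "('p::complex_vector \<Rightarrow> 'v::complex_vector \<Rightarrow> 'w::complex_vector) \<Rightarrow> bool"
  where "cbilinear B \<longleftrightarrow> (\<forall>y. clinear (\<lambda>z. B z y)) \<and> (\<forall>z. clinear (B z))"

text \<open>
  The linear map induced by a bilinear map; it does not depend on the chosen representative
  if the given map is bilinear, see \<open>tensor_lift_pure\<close> and \<open>clinear_tensor_lift\<close>.
\<close>

definition free_lift ::
  "('p \<Rightarrow> 'v \<Rightarrow> 'w::complex_vector) \<Rightarrow> (('p \<times> 'v) \<Rightarrow>\<^sub>0 complex) \<Rightarrow> 'w"
  where "free_lift B s =
    (\<Sum>(z, y)\<in>Poly_Mapping.keys s. Poly_Mapping.lookup s (z, y) *\<^sub>C B z y)"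

definition tensor_lift ::
  "('p::complex_vector \<Rightarrow> 'v::complex_vector \<Rightarrow> 'w::complex_vector) \<Rightarrow> ('p, 'v) tensor \<Rightarrow> 'w"
  where "tensor_lift B t = free_lift B (rep_tensor t)"

lemma free_lift_superset:
  assumes "finite K" "Poly_Mapping.keys s \<subseteq> K"
  shows "free_lift B s = (\<Sum>(z, y)\<in>K. Poly_Mapping.lookup s (z, y) *\<^sub>C B z y)"
  unfolding free_lift_def
  by (rule sum.mono_neutral_left) (use assms in \<open>auto simp: in_keys_iff\<close>)

lemma clinear_free_lift: "clinear (free_lift B)"
proof (rule clinearI)
  fix s t :: "('a \<times> 'b) \<Rightarrow>\<^sub>0 complex" and c :: complex
  let ?K = "Poly_Mapping.keys s \<union> Poly_Mapping.keys t"
  have "finite ?K" by simp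
  then show "free_lift B (s + t) = free_lift B s + free_lift B t"
    by (subst (1 2 3) free_lift_superset[where K = ?K])
      (use Poly_Mapping.keys_add[of s t] in
        \<open>auto simp: lookup_add scaleC_add_left case_prod_unfold sum.distrib\<close>)
  show "free_lift B (c *\<^sub>C s) = c *\<^sub>C free_lift B s"
    by (subst (1 2) free_lift_superset[where K = "Poly_Mapping.keys s"])
      (auto simp: in_keys_iff lookup_scaleC case_prod_unfold scaleC_scaleC scaleC_complex_def
        complex_vector.scale_sum_right)
qed

lemma free_lift_single: "free_lift B (Poly_Mapping.single (z, y) c) = c *\<^sub>C B z y"
  by (subst free_lift_superset[where K = "{(z, y)}"]) auto

lemma free_lift_relators:
  assumes "cbilinear B" and s: "s \<in> complex_vector.span tensor_relators"
  shows "free_lift B s = 0"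
proof -
  interpret L: Vector_Spaces.linear scaleC scaleC "free_lift B" by (rule clinear_free_lift)
  have B: "B (z + z') y = B z y + B z' y" "B z (y + y') = B z y + B z y'"
    "B (c *\<^sub>C z) y = c *\<^sub>C B z y" "B z (c *\<^sub>C y) = c *\<^sub>C B z y" for z z' y y' c
    using assms(1) by (auto simp: cbilinear_def clinear_add clinear_scaleC
        clinear_add[of "\<lambda>z. B z y" for y] clinear_scaleC[of "\<lambda>z. B z y" for y])
  have "free_lift B t = 0" if "t \<in> tensor_relators" for t
    using that by (auto simp: tensor_relators_def L.diff L.scale free_lift_single B scaleC_one)
  then show ?thesis
    using s L.eq_0_on_span by blast
qed

lemma tensor_lift_abs:
  assumes "cbilinear B"
  shows "tensor_lift B (abs_tensor s) = free_lift B s"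
proof -
  interpret L: Vector_Spaces.linear scaleC scaleC "free_lift B" by (rule clinear_free_lift)
  have "tensor_rel (rep_tensor (abs_tensor s)) s"
    using Quotient_rep_abs[OF Quotient_tensor] tensor_rel_refl by blast
  then have "free_lift B (rep_tensor (abs_tensor s) - s) = 0"
    using free_lift_relators[OF assms] by (simp add: tensor_rel_def)
  then show ?thesis by (simp add: tensor_lift_def L.diff)
qed

lemma tensor_lift_pure: "cbilinear B \<Longrightarrow> tensor_lift B (z \<otimes>\<^sub>C y) = B z y"
  by (simp add: pure_tensor.abs_eq tensor_lift_abs free_lift_single scaleC_one)

lemma clinear_tensor_lift:
  assumes "cbilinear B"
  shows "clinear (tensor_lift B)"
proof (rule clinearI)
  fix s t :: "('a, 'b) tensor" and c :: complex
  obtain s' t' where st: "s = abs_tensor s'" "t = abs_tensor t'"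
    by (metis Quotient_abs_rep[OF Quotient_tensor])
  show "tensor_lift B (s + t) = tensor_lift B s + tensor_lift B t"
    by (simp add: st plus_tensor.abs_eq tensor_lift_abs[OF assms] clinear_add[OF clinear_free_lift])
  show "tensor_lift B (c *\<^sub>C s) = c *\<^sub>C tensor_lift B s"
    by (simp add: st scaleC_tensor.abs_eq tensor_lift_abs[OF assms]
        clinear_scaleC[OF clinear_free_lift])
qed

lemma tensor_ext:
  assumes "clinear f" "clinear g" and eq: "\<And>z y. f (z \<otimes>\<^sub>C y) = g (z \<otimes>\<^sub>C y)"
  shows "f t = g t"
proof -
  obtain s where t: "t = abs_tensor s"
    by (metis Quotient_abs_rep[OF Quotient_tensor])
  have single: "f (abs_tensor (Poly_Mapping.single k c)) = g (abs_tensor (Poly_Mapping.single k c))"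
    for k c
  proof -
    obtain z y where k: "k = (z, y)" by (cases k)
    have "Poly_Mapping.single k c = c *\<^sub>C Poly_Mapping.single (z, y) (1 :: complex)"
      by (rule poly_mapping_eqI)
        (simp add: k lookup_scaleC scaleC_complex_def lookup_single when_def)
    then have "abs_tensor (Poly_Mapping.single k c) = c *\<^sub>C (z \<otimes>\<^sub>C y)"
      by (simp add: scaleC_tensor.abs_eq pure_tensor.abs_eq)
    then show ?thesis by (simp add: clinear_scaleC[OF assms(1)] clinear_scaleC[OF assms(2)] eq)
  qed
  have "f (abs_tensor s) = g (abs_tensor s)"
  proof (induction s rule: update_induct)
    case const
    show ?case using single[of _ 0] by simp
  next
    case (update s k c)
    then have "Poly_Mapping.update k c s = s + Poly_Mapping.single k c"
      by (intro poly_mapping_eqI)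
        (auto simp: lookup_update lookup_add lookup_single when_def in_keys_iff)
    with update single show ?case
      by (simp add: clinear_add[OF assms(1)] clinear_add[OF assms(2)] flip: plus_tensor.abs_eq)
  qed
  then show ?thesis by (simp add: t)
qed

definition tensor_map :: "('p::complex_vector \<Rightarrow> 'p) \<Rightarrow> ('v::complex_vector \<Rightarrow> 'v)
    \<Rightarrow> ('p, 'v) tensor \<Rightarrow> ('p, 'v) tensor"
  where "tensor_map f g = tensor_lift (\<lambda>z y. f z \<otimes>\<^sub>C g y)"

lemma cbilinear_tensor_map:
  "clinear f \<Longrightarrow> clinear g \<Longrightarrow> cbilinear (\<lambda>z y. f z \<otimes>\<^sub>C g y)"
  unfolding cbilinear_def
  by (auto intro!: clinearI simp: clinear_add clinear_scaleC pure_tensor_add_left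
      pure_tensor_add_right pure_tensor_scaleC_left pure_tensor_scaleC_right)

lemma tensor_map_pure:
  "clinear f \<Longrightarrow> clinear g \<Longrightarrow> tensor_map f g (z \<otimes>\<^sub>C y) = f z \<otimes>\<^sub>C g y"
  by (simp add: tensor_map_def tensor_lift_pure cbilinear_tensor_map)

lemma clinear_tensor_map: "clinear f \<Longrightarrow> clinear g \<Longrightarrow> clinear (tensor_map f g)"
  by (simp add: tensor_map_def clinear_tensor_lift cbilinear_tensor_map)

section \<open>Modules\<close>

text \<open>
  The algebra is a subset \<open>L\<close> of some ambient complex vector space and acts on a whole
  type; only the values of the action on \<open>L\<close> matter.
\<close>

definition linear_action ::
  "'g::complex_vector set \<Rightarrow> ('g \<Rightarrow> 'v::complex_vector \<Rightarrow> 'v) \<Rightarrow> bool"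
  where "linear_action L act \<longleftrightarrow>
      (\<forall>X\<in>L. clinear (act X))
    \<and> (\<forall>X\<in>L. \<forall>Y\<in>L. \<forall>v. act (X + Y) v = act X v + act Y v)
    \<and> (\<forall>c. \<forall>X\<in>L. \<forall>v. act (c *\<^sub>C X) v = c *\<^sub>C act X v)"

definition lie_module ::
  "'g::complex_vector set \<Rightarrow> ('g \<Rightarrow> 'g \<Rightarrow> 'g) \<Rightarrow> ('g \<Rightarrow> 'v::complex_vector \<Rightarrow> 'v) \<Rightarrow> bool"
  where "lie_module L br act \<longleftrightarrow> linear_action L act
    \<and> (\<forall>X\<in>L. \<forall>Y\<in>L. \<forall>v. act (br X Y) v = act X (act Y v) - act Y (act X v))"

definition operator_algebra_module ::
  "('a::complex_vector \<Rightarrow> 'a) set \<Rightarrow> (('a \<Rightarrow> 'a) \<Rightarrow> 'v::complex_vector \<Rightarrow> 'v) \<Rightarrow> bool"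
  where "operator_algebra_module L act \<longleftrightarrow> linear_action L act
    \<and> (\<forall>v. act id v = v)
    \<and> (\<forall>X\<in>L. \<forall>Y\<in>L. \<forall>v. act (X \<circ> Y) v = act X (act Y v))"

definition submodule ::
  "'g set \<Rightarrow> ('g \<Rightarrow> 'v::complex_vector \<Rightarrow> 'v) \<Rightarrow> 'v set \<Rightarrow> bool"
  where "submodule L act U \<longleftrightarrow>
    complex_vector.subspace U \<and> (\<forall>X\<in>L. \<forall>v\<in>U. act X v \<in> U)"

definition irreducible_action :: "'g set \<Rightarrow> ('g \<Rightarrow> 'v::complex_vector \<Rightarrow> 'v) \<Rightarrow> bool"
  where "irreducible_action L act \<longleftrightarrow>
    (\<exists>v::'v. v \<noteq> 0) \<and> (\<forall>U. submodule L act U \<longrightarrow> U = {0} \<or> U = UNIV)"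

definition module_iso ::
  "'g set \<Rightarrow> ('g \<Rightarrow> 'v::complex_vector \<Rightarrow> 'v) \<Rightarrow> ('g \<Rightarrow> 'w::complex_vector \<Rightarrow> 'w) \<Rightarrow> bool"
  where "module_iso L act act' \<longleftrightarrow>
    (\<exists>\<phi>. clinear \<phi> \<and> bij \<phi> \<and> (\<forall>X\<in>L. \<forall>v. \<phi> (act X v) = act' X (\<phi> v)))"

section \<open>The Weyl algebra and the divergence zero vector fields\<close>

text \<open>
  The Laurent polynomial algebra \<open>A\<^sub>n\<close> is the group algebra of \<open>\<int>\<^sup>n\<close>; its product is the
  convolution product of finitely supported functions.
\<close>

type_synonym 'n laurent = "(int ^ 'n) \<Rightarrow>\<^sub>0 complex"

definition monomial :: "int ^ 'n \<Rightarrow> 'n::finite laurent"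
  where "monomial r = Poly_Mapping.single r 1"

text \<open>The operator \<open>x\<^sub>i \<partial>/\<partial>x\<^sub>i\<close>, which multiplies \<open>x\<^sup>r\<close> by \<open>r\<^sub>i\<close>.\<close>

definition euler :: "'n \<Rightarrow> 'n::finite laurent \<Rightarrow> 'n laurent"
  where "euler i = Poly_Mapping.mapp (\<lambda>r c. of_int (r $ i) * c)"

inductive_set weyl_algebra :: "('n::finite laurent \<Rightarrow> 'n laurent) set" where
  mult: "(\<lambda>f. a * f) \<in> weyl_algebra"
| euler: "euler i \<in> weyl_algebra"
| add: "X \<in> weyl_algebra \<Longrightarrow> Y \<in> weyl_algebra \<Longrightarrow> X + Y \<in> weyl_algebra"
| scaleC: "X \<in> weyl_algebra \<Longrightarrow> c *\<^sub>C X \<in> weyl_algebra"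
| comp: "X \<in> weyl_algebra \<Longrightarrow> Y \<in> weyl_algebra \<Longrightarrow> X \<circ> Y \<in> weyl_algebra"

definition pairing :: "complex ^ 'n \<Rightarrow> int ^ 'n \<Rightarrow> complex"
  where "pairing u r = (\<Sum>i\<in>UNIV. u $ i * of_int (r $ i))"

definition vfield :: "complex ^ 'n \<Rightarrow> int ^ 'n \<Rightarrow> 'n::finite laurent \<Rightarrow> 'n laurent"
  where "vfield u r = (\<lambda>f. monomial r * (\<Sum>i\<in>UNIV. (u $ i) *\<^sub>C euler i f))"

definition div_zero :: "('n::finite laurent \<Rightarrow> 'n laurent) set"
  where "div_zero = complex_vector.span {vfield u r | u r. pairing u r = 0}"

section \<open>Modules over \<open>sl\<^sub>n\<close>\<close>

type_synonym 'n sqmatrix = "complex ^ 'n ^ 'n"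

definition sl :: "'n::finite sqmatrix set"
  where "sl = {A. trace A = 0}"

definition matrix_bracket :: "'n::finite sqmatrix \<Rightarrow> 'n sqmatrix \<Rightarrow> 'n sqmatrix"
  where "matrix_bracket A B = A ** B - B ** A"

definition elem_matrix :: "'n \<Rightarrow> 'n \<Rightarrow> 'n::finite sqmatrix"
  where "elem_matrix i j = (\<chi> k l. if k = i \<and> l = j then 1 else 0)"

text \<open>
  The linear order on the index type identifies it with \<open>{1, \<dots>, n}\<close>; \<open>position i\<close> is the number
  corresponding to \<open>i\<close>.
\<close>

definition position :: "'n::{finite,linorder} \<Rightarrow> nat"
  where "position i = card {..i}"

text \<open>
  \<open>w j\<close> is the eigenvalue of \<open>h\<^sub>j = E\<^sub>j\<^sub>j - E\<^sub>j\<^sub>+\<^sub>1\<^sub>,\<^sub>j\<^sub>+\<^sub>1\<close> for \<open>1 \<le> j \<le> n - 1\<close>.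
\<close>

definition highest_weight_vector ::
  "('n::{finite,linorder} sqmatrix \<Rightarrow> 'v::complex_vector \<Rightarrow> 'v) \<Rightarrow> (nat \<Rightarrow> complex) \<Rightarrow> 'v
    \<Rightarrow> bool"
  where "highest_weight_vector V w v \<longleftrightarrow> v \<noteq> 0
    \<and> (\<forall>i j. i < j \<longrightarrow> V (elem_matrix i j) v = 0)
    \<and> (\<forall>i j. position j = Suc (position i) \<longrightarrow>
          V (elem_matrix i i - elem_matrix j j) v = w (position i) *\<^sub>C v)"

definition fundamental_weight :: "nat \<Rightarrow> nat \<Rightarrow> complex"
  where "fundamental_weight k j = (if j = k then 1 else 0)"

text \<open>
  \<open>V\<close> is the simple finite-dimensional \<open>sl\<^sub>n\<close>-module \<open>V(\<delta>\<^sub>k)\<close>, which is determined by this up to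
  isomorphism; \<open>\<delta>\<^sub>0 = 0\<close> because the positions start at 1.
  Any module isomorphic to \<open>V(\<delta>\<^sub>k)\<close> carries such a structure on its own underlying space.
\<close>

definition is_V_delta ::
  "nat \<Rightarrow> ('n::{finite,linorder} sqmatrix \<Rightarrow> 'v::complex_vector \<Rightarrow> 'v) \<Rightarrow> bool"
  where "is_V_delta k V \<longleftrightarrow>
      lie_module sl matrix_bracket V \<and> irreducible_action sl V
    \<and> (\<exists>B. finite B \<and> complex_vector.span B = (UNIV :: 'v set))
    \<and> (\<exists>v. highest_weight_vector V (fundamental_weight k) v)"

section \<open>The modules \<open>\<F>(P, V)\<close>\<close>

text \<open>
  If \<open>X = \<Sum>\<^sub>r D(u\<^sub>r, r)\<close> then \<open>u\<^sub>r\<close> can be read off from \<open>X(x\<^sub>i) = \<Sum>\<^sub>r (u\<^sub>r)\<^sub>i x\<^sup>r x\<^sub>i\<close>. This makes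
  the linear extension of the action from the spanning set of the \<open>D(u, r)\<close> explicit.
\<close>

definition vcoeff :: "('n::finite laurent \<Rightarrow> 'n laurent) \<Rightarrow> int ^ 'n \<Rightarrow> complex ^ 'n"
  where "vcoeff X r = (\<chi> i. Poly_Mapping.lookup (X (monomial (axis i 1))) (r + axis i 1))"

definition outer :: "int ^ 'n \<Rightarrow> complex ^ 'n \<Rightarrow> 'n sqmatrix"
  where "outer r u = (\<chi> i j. of_int (r $ i) * u $ j)"

definition F_action ::
  "(('n::finite laurent \<Rightarrow> 'n laurent) \<Rightarrow> 'p::complex_vector \<Rightarrow> 'p)
    \<Rightarrow> ('n sqmatrix \<Rightarrow> 'v::complex_vector \<Rightarrow> 'v)
    \<Rightarrow> ('n laurent \<Rightarrow> 'n laurent) \<Rightarrow> ('p, 'v) tensor \<Rightarrow> ('p, 'v) tensor"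
  where "F_action P V X t =
    tensor_map (P X) id t
    + (\<Sum>r | vcoeff X r \<noteq> 0.
         tensor_map (P (\<lambda>f. monomial r * f)) (V (outer r (vcoeff X r))) t)"

lemma lookup_euler: "Poly_Mapping.lookup (euler i f) r = of_int (r $ i) * Poly_Mapping.lookup f r"
  by (auto simp: euler_def Poly_Mapping.lookup_mapp when_def in_keys_iff)

lemma euler_monomial: "euler i (monomial r) = of_int (r $ i) *\<^sub>C monomial r"
  by (rule poly_mapping_eqI)
    (auto simp: lookup_euler lookup_scaleC scaleC_complex_def monomial_def lookup_single when_def)

lemma vcoeff_vfield: "vcoeff (vfield u s) r = (if r = s then u else 0)"
proof -
  have sum: "(\<Sum>j\<in>UNIV. (u $ j) *\<^sub>C euler j (monomial (axis i 1))) = Poly_Mapping.single (axis i 1) (u $ i)"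
    for i
    by (rule poly_mapping_eqI)
      (auto simp: lookup_sum lookup_euler lookup_scaleC scaleC_complex_def monomial_def
        lookup_single when_def axis_def if_distrib cong: if_cong)
  have "vfield u s (monomial (axis i 1)) = Poly_Mapping.single (s + axis i 1) (u $ i)" for i
    unfolding vfield_def sum by (simp add: monomial_def mult_single)
  then show ?thesis
    by (auto simp: vcoeff_def vec_eq_iff lookup_single when_def)
qed

lemma vcoeff_add: "vcoeff (X + Y) r = vcoeff X r + vcoeff Y r"
  and vcoeff_scaleC: "vcoeff (c *\<^sub>C X) r = c *\<^sub>C vcoeff X r"
  and vcoeff_zero: "vcoeff 0 r = 0"
  by (simp_all add: vcoeff_def vec_eq_iff lookup_add scaleC_fun_def lookup_scaleC scaleC_vec_def
      scaleC_complex_def)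

lemma pairing_scaleC: "pairing (c *\<^sub>C u) r = c * pairing u r"
  by (simp add: pairing_def scaleC_vec_def scaleC_complex_def sum_distrib_left mult.assoc)

lemma pairing_zero: "pairing 0 r = 0"
  by (simp add: pairing_def)

lemma pairing_add: "pairing (u + v) r = pairing u r + pairing v r"
  by (simp add: pairing_def sum.distrib algebra_simps)

lemma outer_in_sl: "pairing u r = 0 \<Longrightarrow> outer r u \<in> sl"
  by (simp add: pairing_def outer_def sl_def trace_def mult.commute)

lemma weyl_zero: "0 \<in> weyl_algebra"
proof -
  have "(0 :: 'b::finite laurent \<Rightarrow> 'b laurent) = (\<lambda>f. 0 * f)" by (simp add: fun_eq_iff)
  then show ?thesis using weyl_algebra.mult[of 0] by metis
qed

lemma weyl_sum:
  assumes "finite I" "\<And>i. i \<in> I \<Longrightarrow> X i \<in> weyl_algebra"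
  shows "sum X I \<in> weyl_algebra"
  using assms
proof (induction I rule: finite_induct)
  case empty
  show ?case unfolding sum.empty by (rule weyl_zero)
next
  case (insert x F)
  show ?case
    unfolding sum.insert[OF insert.hyps] by (intro weyl_algebra.add insert) auto
qed

lemma sum_fun_apply: "(sum X I) f = (\<Sum>i\<in>I. X i f)"
  by (induction I rule: infinite_finite_induct) auto

lemma vfield_in_weyl: "vfield u r \<in> weyl_algebra"
proof -
  have "vfield u r = (\<lambda>f. monomial r * f) \<circ> (\<Sum>i\<in>UNIV. (u $ i) *\<^sub>C euler i)"
    by (simp add: vfield_def fun_eq_iff sum_fun_apply scaleC_fun_def)
  then show ?thesis
    by (simp add: weyl_algebra.intros weyl_sum)
qed

lemma div_zero_props:
  fixes X :: "'n::finite laurent \<Rightarrow> 'n laurent"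
  assumes "X \<in> div_zero"
  shows "X \<in> weyl_algebra" "finite {r. vcoeff X r \<noteq> 0}" "\<And>r. pairing (vcoeff X r) r = 0"
proof -
  let ?Q = "\<lambda>X :: 'n laurent \<Rightarrow> 'n laurent. X \<in> weyl_algebra \<and> finite {r. vcoeff X r \<noteq> 0} \<and> (\<forall>r. pairing (vcoeff X r) r = 0)"
  have "?Q X"
    using assms unfolding div_zero_def
  proof (rule complex_vector.span_induct_alt)
    show "?Q 0"
      using weyl_zero unfolding vcoeff_zero pairing_zero by auto
  next
    fix c and D Y :: "'n laurent \<Rightarrow> 'n laurent"
    assume "D \<in> {vfield u r |u r. pairing u r = 0}" and Y: "?Q Y"
    then obtain u s where D: "D = vfield u s" "pairing u s = 0" by blast
    have v: "vcoeff (c *\<^sub>C D + Y) r = c *\<^sub>C (if r = s then u else 0) + vcoeff Y r" for r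
      unfolding vcoeff_add vcoeff_scaleC D vcoeff_vfield ..
    have "{r. vcoeff (c *\<^sub>C D + Y) r \<noteq> 0} \<subseteq> insert s {r. vcoeff Y r \<noteq> 0}"
      unfolding v by (auto split: if_splits)
    then have "finite {r. vcoeff (c *\<^sub>C D + Y) r \<noteq> 0}"
      using Y finite_subset by blast
    moreover have "c *\<^sub>C D + Y \<in> weyl_algebra"
      unfolding D using Y by (intro weyl_algebra.add weyl_algebra.scaleC vfield_in_weyl) simp
    moreover have "pairing (vcoeff (c *\<^sub>C D + Y) r) r = 0" for r
      unfolding v using Y D by (simp add: pairing_add pairing_scaleC pairing_zero)
    ultimately show "?Q (c *\<^sub>C D + Y)" by blast
  qed
  then show "X \<in> weyl_algebra" "finite {r. vcoeff X r \<noteq> 0}" "\<And>r. pairing (vcoeff X r) r = 0"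
    by auto
qed

lemma linear_action_sl_zero: "linear_action sl V \<Longrightarrow> V 0 y = 0"
proof -
  assume V: "linear_action sl V"
  have "(0 :: 'a sqmatrix) \<in> sl" by (simp add: sl_def trace_def)
  then have "V (0 *\<^sub>C 0) y = 0 *\<^sub>C V 0 y" using V unfolding linear_action_def by blast
  then show ?thesis by simp
qed

lemma clinear_id: "clinear id"
  by (rule clinearI) auto

text \<open>The formula defining the action on \<open>\<F>(P, V)\<close>.\<close>

lemma F_action_pure:
  assumes P: "operator_algebra_module weyl_algebra P"
    and V: "lie_module sl matrix_bracket V" and ur: "pairing u r = 0"
  shows "F_action P V (vfield u r) (z \<otimes>\<^sub>C y) =
    P (vfield u r) z \<otimes>\<^sub>C y + P (\<lambda>f. monomial r * f) z \<otimes>\<^sub>C V (outer r u) y"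
proof -
  have lin: "clinear (P (vfield u r))" "clinear (P (\<lambda>f. monomial r * f))" "clinear (V (outer r u))"
    using P V outer_in_sl[OF ur] vfield_in_weyl[of u r] weyl_algebra.mult[of "monomial r"]
    by (auto simp: operator_algebra_module_def lie_module_def linear_action_def)
  show ?thesis
  proof (cases "u = 0")
    case True
    have "outer r u = 0" by (simp add: True outer_def vec_eq_iff)
    then have "V (outer r u) y = 0 *\<^sub>C y"
      using V by (simp add: lie_module_def linear_action_sl_zero)
    then have "P (\<lambda>f. monomial r * f) z \<otimes>\<^sub>C V (outer r u) y =
        0 *\<^sub>C (P (\<lambda>f. monomial r * f) z \<otimes>\<^sub>C y)"
      by (simp only: pure_tensor_scaleC_right)
    then have "P (\<lambda>f. monomial r * f) z \<otimes>\<^sub>C V (outer r u) y = 0"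
      by simp
    moreover have "F_action P V (vfield u r) (z \<otimes>\<^sub>C y) = P (vfield u r) z \<otimes>\<^sub>C y"
      by (simp add: F_action_def tensor_map_pure lin clinear_id vcoeff_vfield True[symmetric])
    ultimately show ?thesis by (simp only: add_0_right)
  next
    case False
    then have "{s. vcoeff (vfield u r) s \<noteq> 0} = {r}" by (auto simp: vcoeff_vfield)
    then show ?thesis
      by (simp add: F_action_def tensor_map_pure lin clinear_id vcoeff_vfield)
  qed
qed

text \<open>Together with \<open>F_action_pure\<close>, this determines \<open>F_action\<close> on \<open>div_zero\<close>.\<close>

lemma linear_action_F_action:
  assumes P: "operator_algebra_module weyl_algebra P" and V: "lie_module sl matrix_bracket V"
  shows "linear_action div_zero (F_action P V)"
proof -
  let ?m = "\<lambda>r f. monomial r * f"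
  let ?T = "\<lambda>r A. tensor_map (P (?m r)) (V A)"
  have linP: "clinear (P X)" if "X \<in> weyl_algebra" for X
    using P that by (auto simp: operator_algebra_module_def linear_action_def)
  have linV: "clinear (V A)" if "A \<in> sl" for A
    using V that by (auto simp: lie_module_def linear_action_def)
  have addP: "P (X + Y) z = P X z + P Y z" "P (c *\<^sub>C X) z = c *\<^sub>C P X z"
    if "X \<in> weyl_algebra" "Y \<in> weyl_algebra" for X Y c z
    using P that by (auto simp: operator_algebra_module_def linear_action_def)
  have addV: "V (A + B) z = V A z + V B z" "V (c *\<^sub>C A) z = c *\<^sub>C V A z"
    if "A \<in> sl" "B \<in> sl" for A B c z
    using V that by (auto simp: lie_module_def linear_action_def)
  have m: "?m r \<in> weyl_algebra" for r :: "int ^ 'a" by (rule weyl_algebra.mult)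
  have linT: "clinear (?T r A)" if "A \<in> sl" for r A
    using that by (intro clinear_tensor_map linP linV m)
  have outer: "outer r (u + v) = outer r u + outer r v" "outer r (c *\<^sub>C u) = c *\<^sub>C outer r u"
    "outer r 0 = 0" for r :: "int ^ 'a" and u v c
    by (simp_all add: outer_def vec_eq_iff scaleC_vec_def scaleC_complex_def algebra_simps)
  have ext: "f t = g t" if "clinear f" "clinear g" "\<And>z y. f (z \<otimes>\<^sub>C y) = g (z \<otimes>\<^sub>C y)"
    for f g :: "('b, 'c) tensor \<Rightarrow> ('b, 'c) tensor" and t
    using that by (rule tensor_ext)
  have sum0: "clinear (\<lambda>t. f t + g t)" "clinear (\<lambda>t. c *\<^sub>C f t)" if "clinear f" "clinear g"
    for f g :: "('b, 'c) tensor \<Rightarrow> ('b, 'c) tensor" and c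
    using that
    by (auto intro!: clinearI simp: clinear_add clinear_scaleC scaleC_add_right scaleC_scaleC
        mult.commute)
  have T: "?T r (A + B) t = ?T r A t + ?T r B t" "?T r (c *\<^sub>C A) t = c *\<^sub>C ?T r A t"
    if "A \<in> sl" "B \<in> sl" "A + B \<in> sl" "c *\<^sub>C A \<in> sl" for r A B c t
  proof -
    show "?T r (A + B) t = ?T r A t + ?T r B t"
      by (rule ext[OF linT sum0(1)[OF linT linT]])
        (use that in \<open>simp_all add: tensor_map_pure linP linV m addV pure_tensor_add_right\<close>)
    show "?T r (c *\<^sub>C A) t = c *\<^sub>C ?T r A t"
      by (rule ext[OF linT sum0(2)[OF linT linT]])
        (use that in \<open>simp_all add: tensor_map_pure linP linV m addV pure_tensor_scaleC_right\<close>)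
  qed
  have S: "tensor_map (P (X + Y)) id t = tensor_map (P X) id t + tensor_map (P Y) id t"
    "tensor_map (P (c *\<^sub>C X)) id t = c *\<^sub>C tensor_map (P X) id t"
    if "X \<in> weyl_algebra" "Y \<in> weyl_algebra" for X Y c and t :: "('b, 'c) tensor"
  proof -
    have X: "X + Y \<in> weyl_algebra" "c *\<^sub>C X \<in> weyl_algebra"
      using that by (auto intro: weyl_algebra.intros)
    have l: "clinear (tensor_map (P Z) (id :: 'c \<Rightarrow> 'c))" if "Z \<in> weyl_algebra" for Z
      using that by (intro clinear_tensor_map linP clinear_id)
    show "tensor_map (P (X + Y)) id t = tensor_map (P X) id t + tensor_map (P Y) id t"
      by (rule ext[OF l sum0(1)[OF l l]])
        (use that X in \<open>simp_all add: tensor_map_pure linP clinear_id addP pure_tensor_add_left\<close>)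
    show "tensor_map (P (c *\<^sub>C X)) id t = c *\<^sub>C tensor_map (P X) id t"
      by (rule ext[OF l sum0(2)[OF l l]])
        (use that X in \<open>simp_all add: tensor_map_pure linP clinear_id addP pure_tensor_scaleC_left\<close>)
  qed
  have T0: "?T r 0 t = 0" for r t
  proof -
    have "(0 :: 'a sqmatrix) \<in> sl" by (simp add: sl_def trace_def)
    from T(2)[OF this this, of 0 r t] this show ?thesis by simp
  qed
  have F: "F_action P V X t =
      tensor_map (P X) id t + (\<Sum>r\<in>K. ?T r (outer r (vcoeff X r)) t)"
    if "finite K" "{r. vcoeff X r \<noteq> 0} \<subseteq> K" for X K t
    unfolding F_action_def
    by (rule arg_cong2[where f = "(+)"], rule refl, rule sum.mono_neutral_left)
      (use that in \<open>auto simp: outer T0\<close>)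
  have sl: "outer r (vcoeff X r) \<in> sl" if "X \<in> div_zero" for X r
    using div_zero_props(3)[OF that] by (rule outer_in_sl)
  have D: "X + Y \<in> div_zero" "c *\<^sub>C X \<in> div_zero" if "X \<in> div_zero" "Y \<in> div_zero"
    for X Y :: "'a laurent \<Rightarrow> 'a laurent" and c
    using that by (auto simp: div_zero_def complex_vector.span_add complex_vector.span_scale)
  show ?thesis
    unfolding linear_action_def
  proof (intro conjI ballI allI)
    fix X :: "'a laurent \<Rightarrow> 'a laurent" assume X: "X \<in> div_zero"
    note p = div_zero_props(1,2)[OF X]
    show "clinear (F_action P V X)"
    proof (rule clinearI)
      fix s t :: "('b, 'c) tensor" and c
      show "F_action P V X (s + t) = F_action P V X s + F_action P V X t"
        by (simp add: F_action_def clinear_add[OF clinear_tensor_map[OF linP[OF p(1)] clinear_id]]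
            clinear_add[OF linT[OF sl[OF X]]] sum.distrib)
      show "F_action P V X (c *\<^sub>C s) = c *\<^sub>C F_action P V X s"
        by (simp add: F_action_def clinear_scaleC[OF clinear_tensor_map[OF linP[OF p(1)] clinear_id]]
            clinear_scaleC[OF linT[OF sl[OF X]]] complex_vector.scale_sum_right scaleC_add_right)
    qed
    fix c and t :: "('b, 'c) tensor"
    have "T": "?T r (outer r (vcoeff (c *\<^sub>C X) r)) t = c *\<^sub>C ?T r (outer r (vcoeff X r)) t" for r
    proof -
      have "c *\<^sub>C outer r (vcoeff X r) \<in> sl"
        using sl[OF D(2)[OF X X], of r c] by (simp add: vcoeff_scaleC outer)
      moreover have "outer r (vcoeff X r) + outer r (vcoeff X r) \<in> sl"
        using sl[OF D(1)[OF X X], of r] unfolding vcoeff_add outer .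
      ultimately show ?thesis
        unfolding vcoeff_scaleC outer by (intro T(2)[OF sl[OF X] sl[OF X]])
    qed
    have K: "{r. vcoeff (c *\<^sub>C X) r \<noteq> 0} \<subseteq> {r. vcoeff X r \<noteq> 0}"
      by (auto simp: vcoeff_scaleC)
    show "F_action P V (c *\<^sub>C X) t = c *\<^sub>C F_action P V X t"
      unfolding F[OF p(2) K] F[OF p(2) order.refl] S(2)[OF p(1) p(1)] T
      by (simp add: complex_vector.scale_sum_right scaleC_add_right)
  next
    fix X Y :: "'a laurent \<Rightarrow> 'a laurent" and t :: "('b, 'c) tensor"
    assume X: "X \<in> div_zero" and Y: "Y \<in> div_zero"
    let ?K = "{r. vcoeff X r \<noteq> 0} \<union> {r. vcoeff Y r \<noteq> 0}"
    have fin: "finite ?K" using div_zero_props(2) X Y by blast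
    have "T": "?T r (outer r (vcoeff (X + Y) r)) t =
      ?T r (outer r (vcoeff X r)) t + ?T r (outer r (vcoeff Y r)) t" for r
    proof -
      have "outer r (vcoeff X r) + outer r (vcoeff Y r) \<in> sl"
        using sl[OF D(1)[OF X Y], of r] by (simp add: vcoeff_add outer)
      moreover have "1 *\<^sub>C outer r (vcoeff X r) \<in> sl"
        using sl[OF X, of r] by simp
      ultimately show ?thesis
        unfolding vcoeff_add outer by (intro T(1)[OF sl[OF X] sl[OF Y]])
    qed
    have K: "{r. vcoeff (X + Y) r \<noteq> 0} \<subseteq> ?K" "{r. vcoeff X r \<noteq> 0} \<subseteq> ?K"
      "{r. vcoeff Y r \<noteq> 0} \<subseteq> ?K"
      by (auto simp: vcoeff_add)
    show "F_action P V (X + Y) t = F_action P V X t + F_action P V Y t"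
      unfolding F[OF fin K(1)] F[OF fin K(2)] F[OF fin K(3)] T
        S(1)[OF div_zero_props(1)[OF X] div_zero_props(1)[OF Y]]
      by (simp add: sum.distrib)
  qed
qed

end

theory Submission
  imports Defs
begin

text \<open>
  Only the implication from an isomorphism \<open>\<phi> : \<F>(P, V) \<rightarrow> \<F>(P', V')\<close> of \<open>\<S>\<^sub>n\<close>-modules to
  isomorphisms of the factors needs an idea. If \<open>\<phi>\<close> commuted with \<open>X \<otimes> 1\<close> for all \<open>X\<close> in the Weyl
  algebra and with \<open>1 \<otimes> A\<close> for all \<open>A\<close> in \<open>sl\<^sub>n\<close>, then Schur's lemma, applied to a restriction of
  \<open>\<phi>\<close> to \<open>P \<otimes> y\<close> followed by a contraction of the right factor, would give \<open>P \<cong> P'\<close>, and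
  symmetrically \<open>V \<cong> V'\<close> (\<open>module_iso_left_factor\<close>, \<open>module_iso_right_factor\<close>). But \<open>D(u, r)\<close> mixes
  the two kinds of operators, so they have to be separated.

  Call a pair \<open>(a, a')\<close> of endomorphisms of \<open>V\<close> and \<open>V'\<close> absorbed if \<open>\<phi>\<close> intertwines \<open>x\<^sup>s \<otimes> a\<close> with
  \<open>x\<^sup>s \<otimes> a'\<close> for every \<open>s\<close>. Since \<open>D(u, 0)\<close> acts as \<open>D(u, 0) \<otimes> 1\<close>, \<open>\<phi>\<close> then intertwines \<open>X \<otimes> a\<close> with
  \<open>X \<otimes> a'\<close> for every \<open>X\<close> in the Weyl algebra (\<open>intertwines_weyl\<close>), and hence \<open>(A a, A a')\<close> is
  absorbed for \<open>A\<close> in \<open>sl\<^sub>n\<close> (\<open>absorbed_left\<close>). So the vectors \<open>a y\<close> with \<open>a\<close> absorbed span a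
  submodule of \<open>V\<close>. If some absorbed \<open>a\<close> is not zero, this submodule is \<open>V\<close>, and on vectors \<open>z \<otimes> a y\<close>
  the required commutations can be read off (\<open>intertwines_if_absorbed\<close>).

  Absorbed pairs come from the squares of the elementary matrices \<open>E\<^sub>i\<^sub>j\<close>, \<open>i \<noteq> j\<close>. The operator
  \<open>D(u, s - k r) D(u, k r)\<close> with \<open>(u|r) = (u|s) = 0\<close> is a polynomial in \<open>k\<close> whose quadratic coefficient
  is \<open>- x\<^sup>s \<otimes> (r u\<^sup>T)\<^sup>2\<close>, which a second difference isolates (\<open>square_identity\<close>); the restriction
  \<open>(u|s) = 0\<close> is removed by commutators with further vector fields (\<open>absorbed_square\<close>).

  It remains to see what happens if all \<open>E\<^sub>i\<^sub>j\<^sup>2\<close> with \<open>i \<noteq> j\<close> vanish on the irreducible module \<open>V\<close>. Then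
  \<open>h = E\<^sub>i\<^sub>i - E\<^sub>j\<^sub>j\<close> satisfies \<open>h\<^sup>3 = h\<close>, so that \<open>V\<close> has weight vectors, their weights take values in
  \<open>{-1, 0, 1}\<close> on all coroots, and there are only finitely many of them. Therefore \<open>V\<close> is finite-dimensional
  with a highest weight that takes at most one nonzero value on the simple coroots, namely \<open>1\<close>: \<open>V\<close> is
  some \<open>V(\<delta>\<^sub>k)\<close> (\<open>is_V_delta\<close> in the locale \<open>square_zero_module\<close>), contrary to assumption.
\<close>

section \<open>Complex linear maps\<close>

lemma clinear_0: "clinear f \<Longrightarrow> f 0 = 0"
  using clinear_scaleC[of f 0 0] by simp

lemma clinear_diff: "clinear f \<Longrightarrow> f (x - y) = f x - f y"
  using clinear_add[of f x "(-1) *\<^sub>C y"] clinear_scaleC[of f "-1" y] by simp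

lemma clinear_sum: "clinear f \<Longrightarrow> f (\<Sum>i\<in>I. g i) = (\<Sum>i\<in>I. f (g i))"
  by (induction I rule: infinite_finite_induct) (simp_all add: clinear_0 clinear_add)

lemma clinear_compose: "clinear f \<Longrightarrow> clinear g \<Longrightarrow> clinear (f \<circ> g)"
  by (rule clinearI) (simp_all add: clinear_add clinear_scaleC)

lemma clinear_minus: "clinear f \<Longrightarrow> f (- x) = - f x"
  using clinear_scaleC[of f "-1" x] by simp

lemma clinear_lincomb:
  "clinear f \<Longrightarrow> clinear g \<Longrightarrow> clinear (\<lambda>z. c *\<^sub>C f z + g z)"
  by (intro clinearI)
      (simp_all add: clinear_add clinear_scaleC scaleC_add_right scaleC_scaleC mult.commute)

lemma clinear_comp: "clinear f \<Longrightarrow> clinear g \<Longrightarrow> clinear (\<lambda>z. f (g z))"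
  using clinear_compose[of f g] by (simp add: o_def)

lemma scaleC_2: "2 *\<^sub>C t = t + t"
  using scaleC_add_left[of 1 1 t] by simp

section \<open>Tensor products\<close>

lemma tensor_induct [case_names pure add]:
  assumes pure: "\<And>z y. Q (z \<otimes>\<^sub>C y)" and add: "\<And>s t. Q s \<Longrightarrow> Q t \<Longrightarrow> Q (s + t)"
  shows "Q t"
proof -
  obtain s where t: "t = abs_tensor s"
    by (metis Quotient_abs_rep[OF Quotient_tensor])
  have single: "Q (abs_tensor (Poly_Mapping.single k c))" for k c
  proof -
    obtain z y where k: "k = (z, y)" by (cases k)
    have "Poly_Mapping.single k c = c *\<^sub>C Poly_Mapping.single (z, y) (1 :: complex)"
      by (rule poly_mapping_eqI)
        (simp add: k lookup_scaleC scaleC_complex_def lookup_single when_def)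
    then have "abs_tensor (Poly_Mapping.single k c) = (c *\<^sub>C z) \<otimes>\<^sub>C y"
      unfolding pure_tensor_scaleC_left by (simp add: scaleC_tensor.abs_eq pure_tensor.abs_eq)
    then show ?thesis by (simp add: pure)
  qed
  have "Q (abs_tensor s)"
  proof (induction s rule: update_induct)
    case const
    show ?case using single[of _ 0] by simp
  next
    case (update s k c)
    then have "Poly_Mapping.update k c s = s + Poly_Mapping.single k c"
      by (intro poly_mapping_eqI)
        (auto simp: lookup_update lookup_add lookup_single when_def in_keys_iff)
    with update single show ?case
      by (simp add: add flip: plus_tensor.abs_eq)
  qed
  then show ?thesis by (simp add: t)
qed

lemma pure_tensor_0_left: "0 \<otimes>\<^sub>C y = 0"
  using pure_tensor_scaleC_left[of 0 0 y] by simp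

lemma clinear_pure_tensor_right: "clinear (\<lambda>y. z \<otimes>\<^sub>C y)"
  by (rule clinearI) (simp_all add: pure_tensor_add_right pure_tensor_scaleC_right)

lemmas pure_tensor_diff_right = clinear_diff[OF clinear_pure_tensor_right]
  and pure_tensor_minus_right = clinear_minus[OF clinear_pure_tensor_right]
  and pure_tensor_0_right = clinear_0[OF clinear_pure_tensor_right]

text \<open>Contraction of the right tensor factor by a functional.\<close>

definition slice_left ::
  "('v::complex_vector \<Rightarrow> complex) \<Rightarrow> ('p::complex_vector, 'v) tensor \<Rightarrow> 'p"
  where "slice_left g = tensor_lift (\<lambda>z y. g y *\<^sub>C z)"

lemma cbilinear_slice: "clinear g \<Longrightarrow> cbilinear (\<lambda>z y. g y *\<^sub>C z)"
  by (auto simp: cbilinear_def clinear_add clinear_scaleC scaleC_add_right scaleC_add_left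
      scaleC_scaleC scaleC_complex_def mult.commute intro!: clinearI)

lemma clinear_slice_left: "clinear g \<Longrightarrow> clinear (slice_left g)"
  by (simp add: slice_left_def clinear_tensor_lift cbilinear_slice)

lemma slice_left_pure: "clinear g \<Longrightarrow> slice_left g (z \<otimes>\<^sub>C y) = g y *\<^sub>C z"
  by (simp add: slice_left_def tensor_lift_pure cbilinear_slice)

lemma clinear_representation:
  assumes "complex_vector.independent B" "complex_vector.span B = UNIV"
  shows "clinear (\<lambda>y. complex_vector.representation B y b)"
  by (rule clinearI)
    (simp_all add: assms complex_vector.representation_add complex_vector.representation_scale
      scaleC_complex_def)

lemma separating_functional:
  fixes y :: "'v::complex_vector"
  assumes "y \<noteq> 0"
  obtains g :: "'v \<Rightarrow> complex" where "clinear g" "g y = 1"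
proof -
  have ind: "complex_vector.independent {y}"
    using assms by simp
  define B where "B = complex_vector.extend_basis {y}"
  have B: "{y} \<subseteq> B" "complex_vector.independent B" "complex_vector.span B = UNIV"
    unfolding B_def using ind
    by (rule complex_vector.extend_basis_superset complex_vector.independent_extend_basis
        complex_vector.span_extend_basis)+
  have "complex_vector.representation B y y = 1"
    using B by (simp add: complex_vector.representation_basis)
  then show ?thesis using clinear_representation[OF B(2,3)] that by blast
qed

lemma pure_tensor_nonzero:
  assumes "z \<noteq> 0" "y \<noteq> 0"
  shows "z \<otimes>\<^sub>C y \<noteq> 0"
proof
  assume 0: "z \<otimes>\<^sub>C y = 0"
  obtain g :: "_ \<Rightarrow> complex" where g: "clinear g" "g y = 1"
    by (rule separating_functional[OF assms(2)])
  have "z = slice_left g (z \<otimes>\<^sub>C y)"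
    unfolding slice_left_pure[OF g(1)] g(2) by simp
  also have "\<dots> = 0"
    unfolding 0 by (rule clinear_0[OF clinear_slice_left[OF g(1)]])
  finally show False using assms(1) by simp
qed

text \<open>
  With coordinate functionals \<open>g\<^sub>b\<close> of a basis of the right factor, every tensor is the sum of the
  \<open>slice_left g\<^sub>b t \<otimes> b\<close>, over any finite set of \<open>b\<close> that contains all those needed. Allowing supersets
  makes the expansion additive in \<open>t\<close>.
\<close>

lemma tensor_eq_0_if_slices_0:
  fixes t :: "('p::complex_vector, 'v::complex_vector) tensor"
  assumes slices: "\<And>g :: 'v \<Rightarrow> complex. clinear g \<Longrightarrow> slice_left g t = 0"
  shows "t = 0"
proof -
  define B :: "'v set" where "B = complex_vector.extend_basis {}"
  have B: "complex_vector.independent B" "complex_vector.span B = UNIV"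
    unfolding B_def
    by (rule complex_vector.independent_extend_basis complex_vector.span_extend_basis,
        rule complex_vector.independent_empty)+
  define g where "g b y = complex_vector.representation B y b" for b y
  have g: "clinear (g b)" for b
    unfolding g_def by (rule clinear_representation[OF B])
  define expands where "expands t F \<longleftrightarrow> t = (\<Sum>b\<in>F. slice_left (g b) t \<otimes>\<^sub>C b)"
    for t :: "('p, 'v) tensor" and F
  have "\<exists>F. finite F \<and> (\<forall>F'. finite F' \<longrightarrow> F \<subseteq> F' \<longrightarrow> expands t F')"
  proof (induction t rule: tensor_induct)
    case (pure z y)
    let ?F = "{b. g b y \<noteq> 0}"
    have "expands (z \<otimes>\<^sub>C y) F'" if "finite F'" "?F \<subseteq> F'" for F'
    proof -
      have "y = (\<Sum>b\<in>?F. g b y *\<^sub>C b)"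
        unfolding g_def
        by (rule complex_vector.sum_nonzero_representation_eq[symmetric]) (use B in auto)
      also have "\<dots> = (\<Sum>b\<in>F'. g b y *\<^sub>C b)"
        by (rule sum.mono_neutral_left) (use that in auto)
      finally have "z \<otimes>\<^sub>C y = z \<otimes>\<^sub>C (\<Sum>b\<in>F'. g b y *\<^sub>C b)" by (rule arg_cong)
      also have "\<dots> = (\<Sum>b\<in>F'. z \<otimes>\<^sub>C (g b y *\<^sub>C b))"
        by (rule clinear_sum)
          (rule clinearI, simp_all add: pure_tensor_add_right pure_tensor_scaleC_right)
      also have "\<dots> = (\<Sum>b\<in>F'. slice_left (g b) (z \<otimes>\<^sub>C y) \<otimes>\<^sub>C b)"
        by (simp add: slice_left_pure g pure_tensor_scaleC_left pure_tensor_scaleC_right)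
      finally show ?thesis unfolding expands_def .
    qed
    moreover have "finite ?F" unfolding g_def by (rule complex_vector.finite_representation)
    ultimately show ?case by blast
  next
    case (add s t)
    then obtain F G where
      F: "finite F" "\<And>F'. finite F' \<Longrightarrow> F \<subseteq> F' \<Longrightarrow> expands s F'" and
      G: "finite G" "\<And>F'. finite F' \<Longrightarrow> G \<subseteq> F' \<Longrightarrow> expands t F'"
      by blast
    have "expands (s + t) F'" if "finite F'" "F \<union> G \<subseteq> F'" for F'
    proof -
      have "expands s F'" "expands t F'" using F(2) G(2) that by auto
      then have "s + t = (\<Sum>b\<in>F'. slice_left (g b) s \<otimes>\<^sub>C b) + (\<Sum>b\<in>F'. slice_left (g b) t \<otimes>\<^sub>C b)"
        unfolding expands_def by (rule arg_cong2)
      also have "\<dots> = (\<Sum>b\<in>F'. slice_left (g b) (s + t) \<otimes>\<^sub>C b)"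
        by (simp add: clinear_add[OF clinear_slice_left[OF g]] pure_tensor_add_left sum.distrib)
      finally show ?thesis unfolding expands_def .
    qed
    then show ?case using finite_UnI[OF F(1) G(1)] by blast
  qed
  then obtain F where "expands t F" by blast
  then have "t = (\<Sum>b\<in>F. slice_left (g b) t \<otimes>\<^sub>C b)" unfolding expands_def .
  also have "\<dots> = 0" using slices[OF g] by (simp add: pure_tensor_0_left)
  finally show ?thesis .
qed

definition tensor_flip ::
  "('p::complex_vector, 'v::complex_vector) tensor \<Rightarrow> ('v, 'p) tensor"
  where "tensor_flip = tensor_lift (\<lambda>z y. y \<otimes>\<^sub>C z)"

lemma cbilinear_flip: "cbilinear (\<lambda>z y. y \<otimes>\<^sub>C z)"
  by (auto simp: cbilinear_def pure_tensor_add_left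
      pure_tensor_add_right pure_tensor_scaleC_left pure_tensor_scaleC_right intro!: clinearI)

lemma clinear_flip: "clinear tensor_flip"
  by (simp add: tensor_flip_def clinear_tensor_lift cbilinear_flip)

lemma tensor_flip_pure: "tensor_flip (z \<otimes>\<^sub>C y) = y \<otimes>\<^sub>C z"
  by (simp add: tensor_flip_def tensor_lift_pure cbilinear_flip)

lemma tensor_flip_flip: "tensor_flip (tensor_flip t) = t"
  by (induction t rule: tensor_induct) (simp_all add: tensor_flip_pure clinear_add[OF clinear_flip])

lemma tensor_flip_map:
  assumes "clinear f" "clinear g"
  shows "tensor_flip (tensor_map f g t) = tensor_map g f (tensor_flip t)"
proof (induction t rule: tensor_induct)
  case (pure z y)
  show ?case
    by (simp only: tensor_flip_pure tensor_map_pure[OF assms] tensor_map_pure[OF assms(2,1)])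
next
  case (add s t)
  then show ?case
    by (simp only: clinear_add[OF clinear_flip] clinear_add[OF clinear_tensor_map[OF assms]]
        clinear_add[OF clinear_tensor_map[OF assms(2,1)]])
qed

section \<open>Schur's lemma and tensor products\<close>

lemma schur:
  assumes irr: "irreducible_action L act" "irreducible_action L act'"
    and lin: "linear_action L act'" and \<psi>: "clinear \<psi>"
    and comm: "\<And>X v. X \<in> L \<Longrightarrow> \<psi> (act X v) = act' X (\<psi> v)" and nz: "\<psi> v0 \<noteq> 0"
  shows "module_iso L act act'"
proof -
  have clin: "clinear (act' X)" if "X \<in> L" for X
    using lin that by (simp add: linear_action_def)
  have "submodule L act {v. \<psi> v = 0}"
    by (auto simp: submodule_def complex_vector.subspace_def clinear_0[OF \<psi>] clinear_add[OF \<psi>]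
        clinear_scaleC[OF \<psi>] comm clinear_0[OF clin])
  then have "{v. \<psi> v = 0} = {0} \<or> {v. \<psi> v = 0} = UNIV"
    using irr(1) by (simp add: irreducible_action_def)
  then have ker: "{v. \<psi> v = 0} = {0}" using nz by blast
  have inj: "inj \<psi>"
  proof (rule injI)
    fix x y assume "\<psi> x = \<psi> y"
    then have "x - y \<in> {v. \<psi> v = 0}" by (simp add: clinear_diff[OF \<psi>])
    then show "x = y" using ker by simp
  qed
  have "submodule L act' (range \<psi>)"
    unfolding submodule_def complex_vector.subspace_def
  proof (intro conjI ballI allI)
    show "0 \<in> range \<psi>" using clinear_0[OF \<psi>] by (metis rangeI)
    show "x + y \<in> range \<psi>" if "x \<in> range \<psi>" "y \<in> range \<psi>" for x y
      using that clinear_add[OF \<psi>] by (metis (no_types, lifting) imageE rangeI)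
    show "c *\<^sub>C x \<in> range \<psi>" if "x \<in> range \<psi>" for c x
      using that clinear_scaleC[OF \<psi>] by (metis (no_types, lifting) imageE rangeI)
    show "act' X x \<in> range \<psi>" if "X \<in> L" "x \<in> range \<psi>" for X x
      using that comm by (metis (no_types, lifting) imageE rangeI)
  qed
  then have "range \<psi> = {0} \<or> range \<psi> = UNIV"
    using irr(2) by (simp add: irreducible_action_def)
  moreover have "range \<psi> \<noteq> {0}" using nz by blast
  ultimately have "bij \<psi>" using inj by (simp add: bij_def)
  then show ?thesis unfolding module_iso_def using \<psi> comm by blast
qed

text \<open>
  As a module over \<open>L\<close>, a tensor product with trivial action on the right factor is a sum of copies
  of the left factor. Inserting a vector \<open>y\<close> and contracting the image by a functional \<open>g\<close> gives a
  homomorphism between the left factors; as \<open>\<phi>\<close> is injective, \<open>g\<close> can be chosen to make it nonzero.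
\<close>

lemma module_iso_left_factor:
  fixes \<phi> :: "('p::complex_vector, 'v::complex_vector) tensor \<Rightarrow>
      ('q::complex_vector, 'w::complex_vector) tensor"
  assumes P: "irreducible_action L P" "linear_action L P"
    and P': "irreducible_action L P'" "linear_action L P'"
    and \<phi>: "clinear \<phi>" "inj \<phi>"
    and comm: "\<And>X t. X \<in> L \<Longrightarrow> \<phi> (tensor_map (P X) id t) = tensor_map (P' X) id (\<phi> t)"
    and y: "(y :: 'v) \<noteq> 0"
  shows "module_iso L P P'"
proof -
  obtain z :: 'p where z: "z \<noteq> 0" using P(1) by (auto simp: irreducible_action_def)
  have "\<phi> (z \<otimes>\<^sub>C y) \<noteq> 0"
    using pure_tensor_nonzero[OF z y] \<phi>(2) clinear_0[OF \<phi>(1)] by (metis injD)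
  then obtain g where g: "clinear g" and nz: "slice_left g (\<phi> (z \<otimes>\<^sub>C y)) \<noteq> 0"
    using tensor_eq_0_if_slices_0 by blast
  have cl: "clinear (P X)" "clinear (P' X)" if "X \<in> L" for X
    using P(2) P'(2) that by (auto simp: linear_action_def)
  have sl: "slice_left g (tensor_map (P' X) id t) = P' X (slice_left g t)" if X: "X \<in> L" for X t
  proof (induction t rule: tensor_induct)
    case (pure z y)
    have "tensor_map (P' X) id (z \<otimes>\<^sub>C y) = P' X z \<otimes>\<^sub>C y"
      using tensor_map_pure[OF cl(2)[OF X] clinear_id, of z y] by simp
    then show ?case
      unfolding slice_left_pure[OF g] clinear_scaleC[OF cl(2)[OF X]]
      by (simp only: slice_left_pure[OF g])
  next
    case (add s t)
    then show ?case
      by (simp only: clinear_add[OF clinear_slice_left[OF g]] clinear_add[OF cl(2)[OF X]]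
          clinear_add[OF clinear_tensor_map[OF cl(2)[OF X] clinear_id]])
  qed
  define \<psi> where "\<psi> z = slice_left g (\<phi> (z \<otimes>\<^sub>C y))" for z
  show ?thesis
  proof (rule schur[OF P(1) P'(1) P'(2)])
    show "clinear \<psi>"
      unfolding \<psi>_def
      by (rule clinearI) (simp_all add: pure_tensor_add_left pure_tensor_scaleC_left
          clinear_add[OF \<phi>(1)] clinear_scaleC[OF \<phi>(1)] clinear_add[OF clinear_slice_left[OF g]]
          clinear_scaleC[OF clinear_slice_left[OF g]])
    show "\<psi> z \<noteq> 0" unfolding \<psi>_def by (rule nz)
    show "\<psi> (P X v) = P' X (\<psi> v)" if "X \<in> L" for X v
    proof -
      have "P X v \<otimes>\<^sub>C y = tensor_map (P X) id (v \<otimes>\<^sub>C y)"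
        using tensor_map_pure[OF cl(1)[OF that] clinear_id, of v y] by simp
      then show ?thesis
        unfolding \<psi>_def by (simp only: comm[OF that] sl[OF that])
    qed
  qed
qed

lemma module_iso_right_factor:
  fixes \<phi> :: "('p::complex_vector, 'v::complex_vector) tensor \<Rightarrow>
      ('q::complex_vector, 'w::complex_vector) tensor"
  assumes V: "irreducible_action L V" "linear_action L V"
    and V': "irreducible_action L V'" "linear_action L V'"
    and \<phi>: "clinear \<phi>" "inj \<phi>"
    and comm: "\<And>X t. X \<in> L \<Longrightarrow> \<phi> (tensor_map id (V X) t) = tensor_map id (V' X) (\<phi> t)"
    and z: "(z :: 'p) \<noteq> 0"
  shows "module_iso L V V'"
proof (rule module_iso_left_factor[OF V V'])
  let ?\<phi> = "tensor_flip \<circ> \<phi> \<circ> tensor_flip"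
  show "clinear ?\<phi>" by (intro clinear_compose clinear_flip \<phi>)
  show "inj ?\<phi>"
  proof (rule injI)
    fix s t assume "?\<phi> s = ?\<phi> t"
    then have "\<phi> (tensor_flip s) = \<phi> (tensor_flip t)" by (metis comp_apply tensor_flip_flip)
    then show "s = t" using \<phi>(2) by (metis injD tensor_flip_flip)
  qed
  show "?\<phi> (tensor_map (V X) id t) = tensor_map (V' X) id (?\<phi> t)" if "X \<in> L" for X t
  proof -
    have "clinear (V X)" "clinear (V' X)"
      using V(2) V'(2) that by (auto simp: linear_action_def)
    then show ?thesis
      by (simp only: comp_apply tensor_flip_map clinear_id comm[OF that])
  qed
  show "z \<noteq> 0" by (rule z)
qed

section \<open>Operators on Laurent polynomials\<close>

abbreviation xmul :: "int ^ 'n \<Rightarrow> 'n::finite laurent \<Rightarrow> 'n laurent"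
  where "xmul r \<equiv> (\<lambda>f. monomial r * f)"

lemma laurent_induct [case_names monomial add]:
  assumes monomial: "\<And>c r. Q (c *\<^sub>C monomial r)" and add: "\<And>f g. Q f \<Longrightarrow> Q g \<Longrightarrow> Q (f + g)"
  shows "Q f"
proof (induction f rule: update_induct)
  case const
  show ?case using monomial[of 0] by simp
next
  case (update f r c)
  have "Poly_Mapping.update r c f = f + c *\<^sub>C monomial r"
    using update(1) by (intro poly_mapping_eqI)
      (auto simp: lookup_update lookup_add lookup_single when_def in_keys_iff monomial_def
        lookup_scaleC scaleC_complex_def)
  then show ?case using update monomial add by simp
qed

lemma monomial_mult: "monomial r * monomial s = monomial (r + s)"
  by (simp add: monomial_def mult_single)

lemma scaleC_mult_laurent:
  fixes f g :: "'n::finite laurent"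
  shows "(c *\<^sub>C f) * g = c *\<^sub>C (f * g)" "f * (c *\<^sub>C g) = c *\<^sub>C (f * g)"
proof -
  have c: "c *\<^sub>C f = Poly_Mapping.single 0 c * f" for f :: "'n laurent"
  proof (induction f rule: laurent_induct)
    case (monomial d r)
    have "d *\<^sub>C monomial r = Poly_Mapping.single r d"
      by (rule poly_mapping_eqI)
        (simp add: monomial_def lookup_scaleC scaleC_complex_def lookup_single when_def)
    moreover have "c *\<^sub>C Poly_Mapping.single r d = Poly_Mapping.single r (c * d)"
      by (rule poly_mapping_eqI) (simp add: lookup_scaleC scaleC_complex_def lookup_single when_def)
    ultimately show ?case by (simp add: mult_single)
  qed (simp add: scaleC_add_right distrib_left)
  show "(c *\<^sub>C f) * g = c *\<^sub>C (f * g)" by (simp add: c mult.assoc)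
  show "f * (c *\<^sub>C g) = c *\<^sub>C (f * g)" unfolding c by (rule mult.left_commute)
qed

lemma euler_add: "euler i (f + g) = euler i f + euler i g"
  by (rule poly_mapping_eqI) (simp add: lookup_euler lookup_add distrib_left)

lemma euler_scaleC: "euler i (c *\<^sub>C f) = c *\<^sub>C euler i f"
  by (rule poly_mapping_eqI) (simp add: lookup_euler lookup_scaleC scaleC_complex_def)

lemma euler_monomial_mult:
  "euler i (monomial s * f) = monomial s * euler i f + of_int (s $ i) *\<^sub>C (monomial s * f)"
proof (induction f rule: laurent_induct)
  case (monomial c r)
  show ?case
    by (simp add: scaleC_mult_laurent euler_scaleC monomial_mult euler_monomial scaleC_scaleC
        ring_distribs scaleC_add_left scaleC_add_right add.commute mult.commute)
next
  case (add f g)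
  then show ?case by (simp add: distrib_left euler_add scaleC_add_right)
qed

lemma xmul_comp: "xmul r \<circ> xmul s = xmul (r + s)"
  by (simp add: fun_eq_iff monomial_mult flip: mult.assoc)

lemma xmul_0: "xmul 0 = id"
  by (simp add: fun_eq_iff monomial_def)

lemma vfield_0: "vfield u 0 = (\<lambda>f. \<Sum>i\<in>UNIV. u $ i *\<^sub>C euler i f)"
  by (simp add: vfield_def monomial_def fun_eq_iff)

lemma vfield_eq_xmul_comp: "vfield u r = xmul r \<circ> vfield u 0"
  unfolding vfield_0 by (simp add: vfield_def fun_eq_iff)

lemma vfield_axis: "vfield (axis i 1) 0 = euler i"
proof
  fix f
  have "vfield (axis i 1) 0 f = (\<Sum>j\<in>UNIV. if j = i then euler i f else 0)"
    unfolding vfield_0 by (rule sum.cong) (auto simp: axis_def)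
  then show "vfield (axis i 1) 0 f = euler i f" by simp
qed

text \<open>The Leibniz rule: \<open>[D(u, 0), x\<^sup>s] = (u|s) x\<^sup>s\<close>.\<close>

lemma vfield_comp_xmul: "vfield u 0 \<circ> xmul s = (xmul s \<circ> vfield u 0) + pairing u s *\<^sub>C xmul s"
  by (simp add: fun_eq_iff vfield_0 euler_monomial_mult scaleC_add_right sum.distrib
      distrib_left scaleC_fun_def sum_distrib_left scaleC_mult_laurent pairing_def complex_vector.scale_sum_left
      scaleC_scaleC)

section \<open>The tensor modules as modules of operators\<close>

lemma tensor_map_lincomb_left:
  assumes "clinear f" "clinear g" "clinear a"
  shows "tensor_map (\<lambda>z. c *\<^sub>C f z + g z) a t = c *\<^sub>C tensor_map f a t + tensor_map g a t"
proof (induction t rule: tensor_induct)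
  case (pure z y)
  show ?case
    using assms by (simp add: tensor_map_pure clinear_lincomb pure_tensor_add_left
        pure_tensor_scaleC_left)
next
  case (add s t)
  then show ?case
    using assms by (simp add: scaleC_add_right clinear_lincomb clinear_add[OF clinear_tensor_map])
qed

lemma tensor_map_lincomb_right:
  assumes "clinear f" "clinear a" "clinear b"
  shows "tensor_map f (\<lambda>y. c *\<^sub>C a y + b y) t = c *\<^sub>C tensor_map f a t + tensor_map f b t"
proof -
  have "tensor_flip (tensor_map f (\<lambda>y. c *\<^sub>C a y + b y) t) =
      tensor_flip (c *\<^sub>C tensor_map f a t + tensor_map f b t)"
    using assms
    by (simp add: tensor_flip_map clinear_lincomb tensor_map_lincomb_left
        clinear_add[OF clinear_flip] clinear_scaleC[OF clinear_flip])
  from arg_cong[OF this, of tensor_flip] show ?thesis by (simp only: tensor_flip_flip)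
qed

lemma tensor_map_comp:
  assumes "clinear f" "clinear g" "clinear a" "clinear b"
  shows "tensor_map (\<lambda>z. f (g z)) (\<lambda>y. a (b y)) t = tensor_map f a (tensor_map g b t)"
proof (induction t rule: tensor_induct)
  case (pure z y)
  show ?case
    using assms clinear_comp[OF assms(1,2)] clinear_comp[OF assms(3,4)]
    by (simp add: tensor_map_pure)
next
  case (add s t)
  then show ?case
    using assms clinear_tensor_map[OF clinear_comp[OF assms(1,2)] clinear_comp[OF assms(3,4)]]
    by (simp add: clinear_add clinear_tensor_map)
qed

lemma tensor_map_id_pure: "clinear f \<Longrightarrow> tensor_map f id (z \<otimes>\<^sub>C y) = f z \<otimes>\<^sub>C y"
  using tensor_map_pure[of f id z y] clinear_id by simp

lemma outer_diff_left: "outer (r - s) u = outer r u - outer s u"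
  and outer_minus_left: "outer (- r) u = - outer r u"
  and outer_0_left: "outer 0 u = 0"
  by (simp_all add: outer_def vec_eq_iff algebra_simps)

lemma pairing_add_right: "pairing u (r + s) = pairing u r + pairing u s"
  and pairing_diff_right: "pairing u (r - s) = pairing u r - pairing u s"
  and pairing_minus_right: "pairing u (- r) = - pairing u r"
  and pairing_0_right: "pairing u 0 = 0"
  by (simp_all add: pairing_def algebra_simps sum.distrib sum_subtractf sum_negf)

lemma vfield_in_div_zero: "pairing u r = 0 \<Longrightarrow> vfield u r \<in> div_zero"
  unfolding div_zero_def by (rule complex_vector.span_base) blast

lemma sl_closed:
  "A \<in> sl \<Longrightarrow> B \<in> sl \<Longrightarrow> A + B \<in> sl" "A \<in> sl \<Longrightarrow> c *\<^sub>C A \<in> sl" "0 \<in> sl" "matrix_bracket A B \<in> sl"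
proof -
  show "A \<in> sl \<Longrightarrow> c *\<^sub>C A \<in> sl"
    by (simp add: sl_def trace_def scaleC_vec_def scaleC_complex_def flip: sum_distrib_left)
  have "trace (A ** B) = trace (B ** A)" by (rule trace_mul_sym)
  then show "matrix_bracket A B \<in> sl" by (simp add: sl_def matrix_bracket_def trace_sub)
qed (simp_all add: sl_def trace_add trace_def sum.distrib)

locale sl_module =
  fixes V :: "'n::finite sqmatrix \<Rightarrow> 'v::complex_vector \<Rightarrow> 'v"
  assumes V: "lie_module sl matrix_bracket V"
begin

lemma clinear_V: "A \<in> sl \<Longrightarrow> clinear (V A)"
  and V_add: "A \<in> sl \<Longrightarrow> B \<in> sl \<Longrightarrow> V (A + B) y = V A y + V B y"
  and V_scaleC: "A \<in> sl \<Longrightarrow> V (c *\<^sub>C A) y = c *\<^sub>C V A y"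
  and V_bracket: "A \<in> sl \<Longrightarrow> B \<in> sl \<Longrightarrow> V (matrix_bracket A B) y = V A (V B y) - V B (V A y)"
  using V by (auto simp: lie_module_def linear_action_def)

lemma V_0: "V 0 y = 0"
  using V by (simp add: lie_module_def linear_action_sl_zero)

lemma V_minus: "A \<in> sl \<Longrightarrow> V (- A) y = - V A y"
  using V_scaleC[of A "-1" y] by simp

lemma V_diff: "A \<in> sl \<Longrightarrow> B \<in> sl \<Longrightarrow> V (A - B) y = V A y - V B y"
  using V_add[of A "- B" y] V_minus[of B y] sl_closed(2)[of B "-1"] by simp

end

locale tensor_modules = sl_module V
  for V :: "'n::finite sqmatrix \<Rightarrow> 'v::complex_vector \<Rightarrow> 'v" +
  fixes P :: "('n laurent \<Rightarrow> 'n laurent) \<Rightarrow> 'p::complex_vector \<Rightarrow> 'p"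
  assumes P: "operator_algebra_module weyl_algebra P"
begin

lemma clinear_P: "X \<in> weyl_algebra \<Longrightarrow> clinear (P X)"
  and P_id: "P id z = z"
  and P_add: "X \<in> weyl_algebra \<Longrightarrow> Y \<in> weyl_algebra \<Longrightarrow> P (X + Y) z = P X z + P Y z"
  and P_scaleC: "X \<in> weyl_algebra \<Longrightarrow> P (c *\<^sub>C X) z = c *\<^sub>C P X z"
  and P_comp: "X \<in> weyl_algebra \<Longrightarrow> Y \<in> weyl_algebra \<Longrightarrow> P (X \<circ> Y) z = P X (P Y z)"
  using P by (auto simp: operator_algebra_module_def linear_action_def)

lemma P_xmul_0: "P (xmul 0) = id"
  unfolding xmul_0 by (rule ext, rule trans[OF P_id id_apply[symmetric]])

lemma P_0: "P 0 z = 0"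
  using P_scaleC[OF weyl_zero, of 0 z] by simp

lemma P_mult_add: "P (\<lambda>h. (f + g) * h) z = P (\<lambda>h. f * h) z + P (\<lambda>h. g * h) z"
proof -
  have "(\<lambda>h. (f + g) * h) = (\<lambda>h. f * h) + (\<lambda>h. g * h)"
    by (simp add: fun_eq_iff distrib_right)
  then show ?thesis by (simp only: P_add weyl_algebra.mult)
qed

lemma P_mult_scaleC: "P (\<lambda>h. (c *\<^sub>C f) * h) z = c *\<^sub>C P (\<lambda>h. f * h) z"
proof -
  have "(\<lambda>h. (c *\<^sub>C f) * h) = c *\<^sub>C (\<lambda>h. f * h)"
    by (simp add: fun_eq_iff scaleC_mult_laurent scaleC_fun_def)
  then show ?thesis by (simp only: P_scaleC weyl_algebra.mult)
qed

lemma P_xmul_xmul: "P (xmul r) (P (xmul s) z) = P (xmul (r + s)) z"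
  by (simp add: weyl_algebra.mult xmul_comp flip: P_comp)

lemma P_vfield: "P (vfield u r) z = P (xmul r) (P (vfield u 0) z)"
  unfolding vfield_eq_xmul_comp[of u r]
  by (simp add: weyl_algebra.mult vfield_in_weyl flip: P_comp)

lemma P_vfield_xmul:
  "P (vfield u 0) (P (xmul s) z) = P (xmul s) (P (vfield u 0) z) + pairing u s *\<^sub>C P (xmul s) z"
proof -
  have "P (vfield u 0) (P (xmul s) z) = P ((xmul s \<circ> vfield u 0) + pairing u s *\<^sub>C xmul s) z"
    unfolding vfield_comp_xmul[symmetric] by (simp add: P_comp weyl_algebra.mult vfield_in_weyl)
  also have "\<dots> = P (xmul s \<circ> vfield u 0) z + pairing u s *\<^sub>C P (xmul s) z"
    by (subst P_add) (simp_all add: P_scaleC weyl_algebra.intros vfield_in_weyl)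
  finally show ?thesis by (simp add: P_comp weyl_algebra.mult vfield_in_weyl)
qed

lemma clinear_F: "pairing u r = 0 \<Longrightarrow> clinear (F_action P V (vfield u r))"
  using linear_action_F_action[OF P V] vfield_in_div_zero[of u r] by (simp add: linear_action_def)

lemma clinear_V_outer: "pairing u r = 0 \<Longrightarrow> clinear (V (outer r u))"
  by (simp add: clinear_V outer_in_sl)

lemma F_vfield:
  assumes "pairing u r = 0"
  shows "F_action P V (vfield u r) t =
    tensor_map (P (vfield u r)) id t + tensor_map (P (xmul r)) (V (outer r u)) t"
proof (induction t rule: tensor_induct)
  case (pure z y)
  show ?case
    unfolding F_action_pure[OF P V assms] tensor_map_id_pure[OF clinear_P[OF vfield_in_weyl]]
      tensor_map_pure[OF clinear_P[OF weyl_algebra.mult] clinear_V_outer[OF assms]] ..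
next
  case (add s t)
  show ?case
    unfolding clinear_add[OF clinear_F[OF assms]] add
        clinear_add[OF clinear_tensor_map[OF clinear_P[OF vfield_in_weyl] clinear_id]]
        clinear_add[OF clinear_tensor_map[OF clinear_P[OF weyl_algebra.mult]
          clinear_V_outer[OF assms]]]
    by (simp only: add_ac)
qed

lemma F_vfield_0: "F_action P V (vfield u 0) t = tensor_map (P (vfield u 0)) id t"
proof -
  have 0: "V (outer 0 u) = (\<lambda>y. 0)"
    by (simp add: fun_eq_iff outer_0_left V_0)
  have "tensor_map (P (xmul 0)) (V (outer 0 u)) t = 0"
    unfolding 0 using tensor_map_lincomb_right[of "P (xmul 0)" "\<lambda>y. 0" "\<lambda>y. 0" "-1" t]
    by (simp add: clinear_P weyl_algebra.mult clinearI)
  then show ?thesis unfolding F_vfield[OF pairing_0_right] by (simp only: add_0_right)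
qed

text \<open>
  For \<open>(u|r) = (u|s) = 0\<close>, with \<open>d = D(u, 0)\<close>, \<open>S = s u\<^sup>T\<close> and \<open>E = r u\<^sup>T\<close>, the operator
  \<open>D(u, s - k r) D(u, k r)\<close> acts as
  \<open>x\<^sup>s d\<^sup>2 \<otimes> 1 + x\<^sup>s d \<otimes> S + k x\<^sup>s \<otimes> S E - k\<^sup>2 x\<^sup>s \<otimes> E\<^sup>2\<close>, because \<open>d\<close> commutes with \<open>x\<^bsup>k r\<^esup>\<close>.
  The second difference at \<open>k = 0\<close> leaves only the last term.
\<close>

lemma square_identity:
  assumes r: "pairing u r = 0" and s: "pairing u s = 0"
  shows "F_action P V (vfield u (s - r)) (F_action P V (vfield u r) t)
      + F_action P V (vfield u (s + r)) (F_action P V (vfield u (- r)) t)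
      - 2 *\<^sub>C F_action P V (vfield u s) (F_action P V (vfield u 0) t)
    = (- 2) *\<^sub>C tensor_map (P (xmul s)) (\<lambda>y. V (outer r u) (V (outer r u) y)) t"
    (is "?L t = ?R t")
proof -
  have orth: "pairing u (s - r) = 0" "pairing u (s + r) = 0" "pairing u (- r) = 0" "pairing u 0 = 0"
    using r s by (simp_all add: pairing_diff_right pairing_add_right pairing_minus_right
        pairing_0_right)
  note F = clinear_F[OF orth(1)] clinear_F[OF orth(2)] clinear_F[OF orth(3)] clinear_F[OF orth(4)]
    clinear_F[OF r] clinear_F[OF s]
  have sl: "outer r u \<in> sl" "outer s u \<in> sl" using r s by (simp_all add: outer_in_sl)
  have E: "clinear (\<lambda>y. V (outer r u) (V (outer r u) y))"
    by (rule clinear_comp[OF clinear_V[OF sl(1)] clinear_V[OF sl(1)]])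
  note Sq = clinear_tensor_map[OF clinear_P[OF weyl_algebra.mult, of "monomial s"] E]
  show ?thesis
  proof (induction t rule: tensor_induct)
    case (pure z y)
    let ?x = "P (xmul s)" and ?d = "P (vfield u 0)"
      and ?S = "V (outer s u)"
    \<comment> \<open>\<open>q\<close> stands for \<open>k r\<close>; the cases \<open>k = 1, -1, 0\<close> are used.\<close>
    have step: "F_action P V (vfield u (s - q)) (F_action P V (vfield u q) (z \<otimes>\<^sub>C y)) =
        ?x (?d (?d z)) \<otimes>\<^sub>C y + ?x (?d z) \<otimes>\<^sub>C ?S y + ?x z \<otimes>\<^sub>C ?S (V (outer q u) y)
          - ?x z \<otimes>\<^sub>C V (outer q u) (V (outer q u) y)"
      if q: "pairing u q = 0" for q
    proof -
      have q': "pairing u (s - q) = 0" using q s by (simp add: pairing_diff_right)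
      have slq: "outer q u \<in> sl" using q by (simp add: outer_in_sl)
      have d: "P (vfield u (s - q)) (P (xmul q) w) = ?x (?d w)" for w
        by (simp add: P_vfield[of u "s - q"] P_vfield_xmul q P_xmul_xmul)
      show ?thesis
        by (simp add: F_action_pure[OF P V q] F_action_pure[OF P V q'] clinear_add[OF clinear_F[OF q']]
            P_vfield[of u q] d P_xmul_xmul outer_diff_left V_diff sl slq
            pure_tensor_add_right pure_tensor_diff_right)
    qed
    show ?case
      using step[OF r] step[of "- r"] step[of 0] r
      by (simp add: pairing_minus_right pairing_0_right outer_minus_left outer_0_left V_0 V_minus sl
        clinear_minus[OF clinear_V[OF sl(1)]] clinear_minus[OF clinear_V[OF sl(2)]]
        clinear_0[OF clinear_V[OF sl(2)]] pure_tensor_0_right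
        pure_tensor_minus_right tensor_map_pure clinear_P weyl_algebra.mult E scaleC_2)
  next
    case (add x y)
    have "?L (x + y) = ?L x + ?L y"
      by (simp only: F[THEN clinear_add] scaleC_add_right) (simp add: algebra_simps)
    also have "\<dots> = ?R x + ?R y" by (simp only: add)
    also have "\<dots> = ?R (x + y)" by (simp only: Sq[THEN clinear_add] scaleC_add_right)
    finally show ?case .
  qed
qed

text \<open>
  The commutator of \<open>D(w, t)\<close> with \<open>x\<^sup>s \<otimes> a\<close>: the first summand comes from the Leibniz rule, the
  second one from the commutator of \<open>t w\<^sup>T\<close> with \<open>a\<close>. No derivatives remain, so the operators of the
  form \<open>x\<^sup>s \<otimes> a\<close> are stable under such commutators.
\<close>

lemma bracket_identity:
  assumes wt: "pairing w t = 0" and a: "clinear a"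
  shows "F_action P V (vfield w t) (tensor_map (P (xmul s)) a x)
      - tensor_map (P (xmul s)) a (F_action P V (vfield w t) x)
    = tensor_map (P (xmul (s + t)))
        (\<lambda>y. pairing w s *\<^sub>C a y + (V (outer t w) (a y) - a (V (outer t w) y))) x"
proof -
  have X: "clinear (P (xmul s))" for s by (simp add: clinear_P weyl_algebra.mult)
  have b: "clinear (\<lambda>y. pairing w s *\<^sub>C a y + (V (outer t w) (a y) - a (V (outer t w) y)))"
    using a clinear_V_outer[OF wt]
    by (intro clinearI) (simp_all add: clinear_add clinear_scaleC scaleC_add_right scaleC_scaleC
        complex_vector.scale_right_diff_distrib mult.commute)
  show ?thesis
  proof (induction x rule: tensor_induct)
    case (pure z y)
    show ?case
      using a
      by (simp add: F_action_pure[OF P V wt] tensor_map_pure X b P_vfield[of w t] P_vfield_xmul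
          clinear_add[OF X] clinear_scaleC[OF X] P_xmul_xmul
          clinear_add[OF clinear_tensor_map[OF X a]]
          pure_tensor_add_left pure_tensor_add_right pure_tensor_diff_right
          pure_tensor_scaleC_left pure_tensor_scaleC_right add.commute[of t s])
  next
    case (add x y)
    then show ?case
      by (simp add: clinear_add[OF clinear_F[OF wt]] clinear_add[OF clinear_tensor_map[OF X a]]
          clinear_add[OF clinear_tensor_map[OF X b]] add_diff_add flip: add)
  qed
qed

end

section \<open>Pairs of operators absorbed by an intertwiner\<close>

locale tensor_intertwiner = A: tensor_modules V P + B: tensor_modules V' P'
  for P :: "('n::finite laurent \<Rightarrow> 'n laurent) \<Rightarrow> 'p::complex_vector \<Rightarrow> 'p"
    and V :: "'n sqmatrix \<Rightarrow> 'v::complex_vector \<Rightarrow> 'v"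
    and P' :: "('n laurent \<Rightarrow> 'n laurent) \<Rightarrow> 'q::complex_vector \<Rightarrow> 'q"
    and V' :: "'n sqmatrix \<Rightarrow> 'w::complex_vector \<Rightarrow> 'w" +
  fixes \<phi> :: "('p, 'v) tensor \<Rightarrow> ('q, 'w) tensor"
  assumes \<phi>: "clinear \<phi>"
    and \<phi>_vfield: "\<And>u r t. pairing u r = 0 \<Longrightarrow>
      \<phi> (F_action P V (vfield u r) t) = F_action P' V' (vfield u r) (\<phi> t)"
begin

definition intertwines ::
  "('n laurent \<Rightarrow> 'n laurent) \<Rightarrow> ('v \<Rightarrow> 'v) \<Rightarrow> ('w \<Rightarrow> 'w) \<Rightarrow> bool"
  where "intertwines X a a' \<longleftrightarrow> (\<forall>t. \<phi> (tensor_map (P X) a t) = tensor_map (P' X) a' (\<phi> t))"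

definition absorbed :: "('v \<Rightarrow> 'v) \<Rightarrow> ('w \<Rightarrow> 'w) \<Rightarrow> bool"
  where "absorbed a a' \<longleftrightarrow> clinear a \<and> clinear a' \<and> (\<forall>s. intertwines (xmul s) a a')"

lemma intertwines_lincomb_right:
  assumes "X \<in> weyl_algebra" "clinear a" "clinear a'" "clinear b" "clinear b'"
    and "intertwines X a a'" "intertwines X b b'"
  shows "intertwines X (\<lambda>y. c *\<^sub>C a y + b y) (\<lambda>y. c *\<^sub>C a' y + b' y)"
  using assms
  by (simp add: intertwines_def tensor_map_lincomb_right A.clinear_P B.clinear_P
      clinear_add[OF \<phi>] clinear_scaleC[OF \<phi>])

text \<open>
  Assuming the linear relation only for the actions of \<open>Z\<close>, \<open>X\<close> and \<open>Y\<close> avoids having to derive it in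
  the Weyl algebra itself.
\<close>

lemma intertwines_lincomb_left:
  assumes "X \<in> weyl_algebra" "Y \<in> weyl_algebra" "clinear a" "clinear a'"
    and PZ: "\<And>z. P Z z = c *\<^sub>C P X z + P Y z" "\<And>z. P' Z z = c *\<^sub>C P' X z + P' Y z"
    and "intertwines X a a'" "intertwines Y a a'"
  shows "intertwines Z a a'"
proof -
  have "P Z = (\<lambda>z. c *\<^sub>C P X z + P Y z)" "P' Z = (\<lambda>z. c *\<^sub>C P' X z + P' Y z)"
    using PZ by (simp_all add: fun_eq_iff)
  then show ?thesis
    using assms
    by (simp add: intertwines_def tensor_map_lincomb_left A.clinear_P B.clinear_P
        clinear_add[OF \<phi>] clinear_scaleC[OF \<phi>])
qed

lemma intertwines_square:
  assumes r: "pairing u r = 0" and s: "pairing u s = 0"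
  shows "intertwines (xmul s)
    (\<lambda>y. V (outer r u) (V (outer r u) y)) (\<lambda>y. V' (outer r u) (V' (outer r u) y))"
  unfolding intertwines_def
proof
  fix t
  have orth: "pairing u (s - r) = 0" "pairing u (s + r) = 0" "pairing u (- r) = 0" "pairing u 0 = 0"
    using r s by (simp_all add: pairing_diff_right pairing_add_right pairing_minus_right
        pairing_0_right)
  let ?T = "tensor_map (P (xmul s)) (\<lambda>y. V (outer r u) (V (outer r u) y)) t"
  let ?T' = "tensor_map (P' (xmul s)) (\<lambda>y. V' (outer r u) (V' (outer r u) y)) (\<phi> t)"
  have "(-2) *\<^sub>C \<phi> ?T = \<phi> ((-2) *\<^sub>C ?T)" by (simp only: clinear_scaleC[OF \<phi>])
  also have "\<dots> = (-2) *\<^sub>C ?T'"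
    unfolding A.square_identity[OF r s, symmetric] B.square_identity[OF r s, symmetric]
    by (simp only: clinear_add[OF \<phi>] clinear_diff[OF \<phi>] clinear_scaleC[OF \<phi>]
        \<phi>_vfield r s orth)
  finally show "\<phi> ?T = ?T'" by simp
qed

lemma intertwines_bracket:
  assumes wt: "pairing w t = 0" and a: "clinear a" "clinear a'"
    and int: "intertwines (xmul s) a a'"
  shows "intertwines (xmul (s + t))
    (\<lambda>y. pairing w s *\<^sub>C a y + (V (outer t w) (a y) - a (V (outer t w) y)))
    (\<lambda>y. pairing w s *\<^sub>C a' y + (V' (outer t w) (a' y) - a' (V' (outer t w) y)))"
  using int
  unfolding intertwines_def A.bracket_identity[OF wt a(1), symmetric]
    B.bracket_identity[OF wt a(2), symmetric]
  by (simp add: clinear_diff[OF \<phi>] \<phi>_vfield[OF wt])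

lemma absorbed_lincomb: "absorbed a a' \<Longrightarrow> absorbed b b' \<Longrightarrow>
    absorbed (\<lambda>y. c *\<^sub>C a y + b y) (\<lambda>y. c *\<^sub>C a' y + b' y)"
  by (simp add: absorbed_def clinear_lincomb intertwines_lincomb_right weyl_algebra.mult)

text \<open>\<open>D(u, 0)\<close> acts on the tensor modules as \<open>D(u, 0) \<otimes> 1\<close>.\<close>

lemma intertwines_comp_vfield:
  assumes R: "R \<in> weyl_algebra" and a: "clinear a" "clinear a'" and int: "intertwines R a a'"
  shows "intertwines (R \<circ> vfield u 0) a a'"
proof -
  let ?D = "vfield u 0"
  have "P (R \<circ> ?D) = (\<lambda>z. P R (P ?D z))" "P' (R \<circ> ?D) = (\<lambda>z. P' R (P' ?D z))"
    using R by (simp_all add: fun_eq_iff A.P_comp B.P_comp vfield_in_weyl)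
  moreover have "tensor_map (\<lambda>z. P R (P ?D z)) a t = tensor_map (P R) a (F_action P V ?D t)" for t
    using tensor_map_comp[OF A.clinear_P[OF R] A.clinear_P[OF vfield_in_weyl] a(1) clinear_id, of u 0]
    by (simp add: A.F_vfield_0)
  moreover have "tensor_map (\<lambda>z. P' R (P' ?D z)) a' t = tensor_map (P' R) a' (F_action P' V' ?D t)" for t
    using tensor_map_comp[OF B.clinear_P[OF R] B.clinear_P[OF vfield_in_weyl] a(2) clinear_id, of u 0]
    by (simp add: B.F_vfield_0)
  ultimately show ?thesis
    using int by (simp add: intertwines_def \<phi>_vfield pairing_0_right)
qed

text \<open>
  Multiplying \<open>x\<^sup>s \<otimes> a\<close> on the right by \<open>D(u, 0) \<otimes> 1\<close> keeps it intertwined, so differential operators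
  can be built up factor by factor. Right multiplication by \<open>x\<^sup>s \<otimes> 1\<close> alone need not keep it so, hence the
  invariant of the induction is that \<open>Y x\<^sup>s \<otimes> a\<close> is intertwined for all \<open>s\<close> at once; it passes from
  \<open>Y\<close> to \<open>Y X\<close> for every generator \<open>X\<close> and therefore for every \<open>X\<close>.
\<close>

lemma intertwines_weyl:
  assumes abs: "absorbed a a'" and X: "X \<in> weyl_algebra"
  shows "intertwines X a a'"
proof -
  have a: "clinear a" "clinear a'" using abs by (simp_all add: absorbed_def)
  note W = weyl_algebra.mult weyl_algebra.euler weyl_algebra.comp
  note P_simps = A.P_comp B.P_comp A.P_0 B.P_0 A.P_add B.P_add A.P_scaleC B.P_scaleC
    A.P_mult_add B.P_mult_add A.P_mult_scaleC B.P_mult_scaleC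
    clinear_add[OF A.clinear_P] clinear_add[OF B.clinear_P]
    clinear_scaleC[OF A.clinear_P] clinear_scaleC[OF B.clinear_P]
  have base: "intertwines (xmul s) a a'" for s
    using abs by (simp add: absorbed_def)
  have zero: "intertwines 0 a a'"
    by (rule intertwines_lincomb_left[OF W(1) W(1) a, where c = "-1"])
      (use base[of 0] in \<open>simp_all add: P_simps\<close>)
  have all_coeffs: "intertwines (Y \<circ> (\<lambda>f. g * f)) a a'"
    if Y: "Y \<in> weyl_algebra" and int: "\<And>s. intertwines (Y \<circ> xmul s) a a'" for Y g
  proof (induction g rule: laurent_induct)
    case (monomial c r)
    show ?case
      by (rule intertwines_lincomb_left[where c = c, OF W(3)[OF Y W(1)] weyl_zero a _ _ int[of r] zero])
        (simp_all only: P_simps W Y add_0_right)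
  next
    case (add f g)
    show ?case
      by (rule intertwines_lincomb_left[where c = 1, OF W(3)[OF Y W(1)] W(3)[OF Y W(1)] a _ _ add])
        (simp_all only: P_simps W Y scaleC_one)
  qed
  have "\<forall>Y\<in>weyl_algebra. (\<forall>s. intertwines (Y \<circ> xmul s) a a') \<longrightarrow>
      (\<forall>s. intertwines (Y \<circ> X \<circ> xmul s) a a')"
    using X
  proof induction
    case (mult g)
    have "Y \<circ> (\<lambda>f. g * f) \<circ> xmul s = Y \<circ> (\<lambda>f. (g * monomial s) * f)"
      for Y :: "'n laurent \<Rightarrow> 'n laurent" and s
      by (simp add: fun_eq_iff mult.assoc)
    then show ?case by (simp only:) (blast intro: all_coeffs)
  next
    case (euler i)
    \<comment> \<open>Moving \<open>\<partial>\<^sub>i\<close> past \<open>x\<^sup>s\<close> gives \<open>Y \<partial>\<^sub>i x\<^sup>s = s\<^sub>i Y x\<^sup>s + Y x\<^sup>s \<partial>\<^sub>i\<close>.\<close>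
    have "intertwines (Y \<circ> euler i \<circ> xmul s) a a'"
      if Y: "Y \<in> weyl_algebra" and int: "\<And>s. intertwines (Y \<circ> xmul s) a a'" for Y s
    proof (rule intertwines_lincomb_left)
      let ?D = "vfield (axis i 1) 0"
      show "intertwines (Y \<circ> xmul s) a a'" by (rule int)
      show "intertwines (Y \<circ> xmul s \<circ> ?D) a a'"
        by (rule intertwines_comp_vfield[OF W(3)[OF Y W(1)] a int])
      show "P (Y \<circ> euler i \<circ> xmul s) z =
          pairing (axis i 1) s *\<^sub>C P (Y \<circ> xmul s) z + P (Y \<circ> xmul s \<circ> ?D) z" for z
        by (simp only: P_simps W Y vfield_in_weyl A.P_vfield_xmul vfield_axis[symmetric] add.commute)
      show "P' (Y \<circ> euler i \<circ> xmul s) z =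
          pairing (axis i 1) s *\<^sub>C P' (Y \<circ> xmul s) z + P' (Y \<circ> xmul s \<circ> ?D) z" for z
        by (simp only: P_simps W Y vfield_in_weyl B.P_vfield_xmul vfield_axis[symmetric] add.commute)
    qed (simp_all add: W Y vfield_in_weyl a)
    then show ?case by blast
  next
    case (add X1 X2)
    have "intertwines (Y \<circ> (X1 + X2) \<circ> xmul s) a a'"
      if Y: "Y \<in> weyl_algebra" and int: "\<And>s. intertwines (Y \<circ> xmul s) a a'" for Y s
    proof (rule intertwines_lincomb_left[where c = 1])
      show "intertwines (Y \<circ> X1 \<circ> xmul s) a a'" "intertwines (Y \<circ> X2 \<circ> xmul s) a a'"
        using add.IH Y int by blast+
    qed (simp_all only: P_simps W Y add.hyps a weyl_algebra.add scaleC_one)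
    then show ?case by blast
  next
    case (scaleC X c)
    have "intertwines (Y \<circ> (c *\<^sub>C X) \<circ> xmul s) a a'"
      if Y: "Y \<in> weyl_algebra" and int: "\<And>s. intertwines (Y \<circ> xmul s) a a'" for Y s
    proof (rule intertwines_lincomb_left[where c = c])
      show "intertwines (Y \<circ> X \<circ> xmul s) a a'" using scaleC.IH Y int by blast
      show "intertwines 0 a a'" by (rule zero)
    qed (simp_all only: P_simps W Y scaleC.hyps a weyl_algebra.scaleC weyl_zero add_0_right)
    then show ?case by blast
  next
    case (comp X1 X2)
    have "\<forall>s. intertwines ((Y \<circ> X1) \<circ> X2 \<circ> xmul s) a a'"
      if Y: "Y \<in> weyl_algebra" and int: "\<forall>s. intertwines (Y \<circ> xmul s) a a'" for Y
      using comp.IH Y int weyl_algebra.comp[OF Y comp.hyps(1)] by blast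
    then show ?case by (simp only: o_assoc) blast
  qed
  moreover have "\<forall>s. intertwines (xmul 0 \<circ> xmul s) a a'"
    unfolding xmul_comp using base by blast
  ultimately have "intertwines (xmul 0 \<circ> X \<circ> xmul 0) a a'"
    using weyl_algebra.mult by blast
  then show ?thesis by (simp only: xmul_0 id_comp comp_id)
qed

end

section \<open>Generators of the special linear Lie algebra\<close>

lemma outer_axis: "outer (axis i 1) (axis j 1) = elem_matrix i j"
  by (auto simp: outer_def elem_matrix_def vec_eq_iff axis_def)

lemma axis_nth: "axis k x $ i = (if i = k then x else 0)"
  by (simp add: axis_def)

lemma pairing_axis: "pairing (axis j c) s = c * of_int (s $ j)"
proof -
  have "pairing (axis j c) s = (\<Sum>i\<in>UNIV. if i = j then c * of_int (s $ j) else 0)"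
    unfolding pairing_def by (rule sum.cong) (auto simp: axis_def)
  then show ?thesis by simp
qed

lemma elem_matrix_in_sl: "i \<noteq> j \<Longrightarrow> elem_matrix i j \<in> sl"
  by (auto simp: sl_def trace_def elem_matrix_def intro!: sum.neutral)

lemma elem_matrix_diag_in_sl: "elem_matrix i i - elem_matrix j j \<in> sl"
  by (simp add: sl_def trace_def elem_matrix_def sum_subtractf)

lemma matrix_diff_mult:
  fixes A B C :: "'n::finite sqmatrix"
  shows "(A - B) ** C = A ** C - B ** C" "C ** (A - B) = C ** A - C ** B"
  by (simp_all add: vec_eq_iff matrix_matrix_mult_def algebra_simps sum_subtractf)

lemma elem_matrix_mult:
  "elem_matrix i j ** elem_matrix k l = (if j = k then elem_matrix i l else 0)"
proof -
  have "(elem_matrix i j ** elem_matrix k l) $ a $ b =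
      (if j = k then elem_matrix i l else 0) $ a $ b" for a b
  proof -
    have "(elem_matrix i j ** elem_matrix k l) $ a $ b =
        (\<Sum>c\<in>UNIV. elem_matrix i j $ a $ c * elem_matrix k l $ c $ b)"
      by (simp add: matrix_matrix_mult_def)
    also have "\<dots> = (\<Sum>c\<in>UNIV. if c = j then (if a = i \<and> j = k \<and> b = l then 1 else 0) else 0)"
      by (rule sum.cong) (auto simp: elem_matrix_def)
    finally show ?thesis by (simp add: elem_matrix_def)
  qed
  then show ?thesis by (simp add: vec_eq_iff)
qed

text \<open>
  The diagonal part \<open>\<Sum>\<^sub>i a\<^sub>i\<^sub>i E\<^sub>i\<^sub>i\<close> of a traceless matrix does not change when \<open>E\<^sub>k\<^sub>k\<close>, for a fixed \<open>k\<close>, is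
  subtracted from each \<open>E\<^sub>i\<^sub>i\<close>.
\<close>

lemma sl_induct [consumes 1, case_names off_diag diag lincomb]:
  assumes A: "A \<in> sl"
    and off_diag: "\<And>i j. i \<noteq> j \<Longrightarrow> Q (elem_matrix i j)"
    and diag: "\<And>i j. Q (elem_matrix i i - elem_matrix j j)"
    and lincomb: "\<And>c A B. A \<in> sl \<Longrightarrow> B \<in> sl \<Longrightarrow> Q A \<Longrightarrow> Q B \<Longrightarrow> Q (c *\<^sub>C A + B)"
  shows "Q (A :: 'n::finite sqmatrix)"
proof -
  fix k :: 'n
  define G :: "'n \<times> 'n \<Rightarrow> 'n sqmatrix" where
    "G = (\<lambda>(i, j). elem_matrix i j - (if i = j then elem_matrix k k else 0))"
  have G: "Q (G p) \<and> G p \<in> sl" for p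
    using off_diag[of "fst p" "snd p"] diag[of "fst p" k] elem_matrix_in_sl[of "fst p" "snd p"]
      elem_matrix_diag_in_sl[of "fst p" k]
    by (cases p) (auto simp: G_def)
  have "Q (\<Sum>p\<in>I. A $ fst p $ snd p *\<^sub>C G p) \<and> (\<Sum>p\<in>I. A $ fst p $ snd p *\<^sub>C G p) \<in> sl"
    if "finite I" for I
    using that
  proof induction
    case empty
    show ?case using diag[of k k] by (simp add: sl_closed)
  next
    case (insert p I)
    then show ?case by (simp add: lincomb G sl_closed)
  qed
  from this[OF finite] have "Q (\<Sum>p\<in>UNIV. A $ fst p $ snd p *\<^sub>C G p)" by (rule conjunct1)
  moreover have entry: "(\<Sum>p\<in>UNIV. A $ fst p $ snd p *\<^sub>C G p) $ a $ b = A $ a $ b" for a b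
  proof -
    have "(\<Sum>p\<in>UNIV. A $ fst p $ snd p *\<^sub>C G p) $ a $ b =
        (\<Sum>i\<in>UNIV. \<Sum>j\<in>UNIV. A $ i $ j * (G (i, j) $ a $ b))"
      by (simp add: sum_component scaleC_vec_def scaleC_complex_def sum.cartesian_product
          case_prod_unfold flip: UNIV_Times_UNIV)
    also have "\<dots> = (\<Sum>i\<in>UNIV. \<Sum>j\<in>UNIV. (if j = b then if i = a then A $ a $ b else 0 else 0)
        - (if j = i then A $ i $ i * (elem_matrix k k $ a $ b) else 0))"
      by (intro sum.cong) (auto simp: G_def elem_matrix_def)
    also have "\<dots> = A $ a $ b - trace A * (elem_matrix k k $ a $ b)"
      by (simp add: sum_subtractf trace_def sum_distrib_right)
    finally show ?thesis using A by (simp add: sl_def)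
  qed
  have "(\<Sum>p\<in>UNIV. A $ fst p $ snd p *\<^sub>C G p) = A"
    unfolding vec_eq_iff using entry by blast
  ultimately show ?thesis by (simp only:)
qed

text \<open>
  The matrices \<open>r u\<^sup>T\<close> that occur in the action of the vector fields span \<open>sl\<^sub>n\<close>. For the diagonal ones,
  \<open>(e\<^sub>i + e\<^sub>j) (e\<^sub>i - e\<^sub>j)\<^sup>T = E\<^sub>i\<^sub>i - E\<^sub>i\<^sub>j + E\<^sub>j\<^sub>i - E\<^sub>j\<^sub>j\<close>.
\<close>

lemma sl_outer_induct [consumes 1, case_names outer lincomb]:
  assumes A: "A \<in> sl"
    and outer: "\<And>u r. pairing u r = 0 \<Longrightarrow> Q (outer r u)"
    and lincomb: "\<And>c A B. A \<in> sl \<Longrightarrow> B \<in> sl \<Longrightarrow> Q A \<Longrightarrow> Q B \<Longrightarrow> Q (c *\<^sub>C A + B)"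
  shows "Q A"
  using A
proof (induction rule: sl_induct)
  case off_diag: (off_diag i j)
  then show ?case
    using outer[of "axis j 1" "axis i 1"] by (simp add: outer_axis pairing_axis axis_nth)
next
  case (diag i j)
  show ?case
  proof (cases "i = j")
    case True
    then show ?thesis using outer[of 0 0] by (simp add: pairing_zero outer_0_left)
  next
    case False
    let ?u = "axis i 1 - axis j 1" and ?r = "axis i 1 + axis j 1"
    have u: "pairing ?u ?r = 0"
      using pairing_add[of ?u "axis j 1" ?r] False by (simp add: pairing_axis axis_nth)
    have E: "Q (elem_matrix a b)" "elem_matrix a b \<in> sl" if "a \<noteq> b" for a b
      using that outer[of "axis b 1" "axis a 1"] elem_matrix_in_sl
      by (auto simp: outer_axis pairing_axis axis_nth)
    have o: "outer ?r ?u \<in> sl" by (rule outer_in_sl[OF u])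
    have "Q (1 *\<^sub>C elem_matrix i j + ((- 1) *\<^sub>C elem_matrix j i + outer ?r ?u))"
      using False by (intro lincomb outer u E o sl_closed) auto
    moreover have "1 *\<^sub>C elem_matrix i j + ((- 1) *\<^sub>C elem_matrix j i + outer ?r ?u) =
        elem_matrix i i - elem_matrix j j"
      by (auto simp: vec_eq_iff outer_def elem_matrix_def axis_nth)
    ultimately show ?thesis by (simp only:)
  qed
qed (rule lincomb)

section \<open>Absorbed pairs form a left ideal that contains squares\<close>

context tensor_modules
begin

lemma F_vfield_tensor_map:
  assumes ur: "pairing u r = 0" and a: "clinear a"
  shows "F_action P V (vfield u r) (tensor_map (P (xmul (s - r))) a t) =
    tensor_map (P (vfield u r \<circ> xmul (s - r))) a t
      + tensor_map (P (xmul s)) (\<lambda>y. V (outer r u) (a y)) t"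
proof -
  note X = clinear_P[OF weyl_algebra.mult] and D = clinear_P[OF vfield_in_weyl]
  have "P (vfield u r \<circ> xmul (s - r)) = (\<lambda>z. P (vfield u r) (P (xmul (s - r)) z))"
    by (simp only: fun_eq_iff P_comp weyl_algebra.mult vfield_in_weyl simp_thms)
  then have 1: "tensor_map (P (vfield u r)) id (tensor_map (P (xmul (s - r))) a t) =
      tensor_map (P (vfield u r \<circ> xmul (s - r))) a t"
    using tensor_map_comp[OF D X clinear_id a, of u r "monomial (s - r)" t] by simp
  have "P (xmul s) = (\<lambda>z. P (xmul r) (P (xmul (s - r)) z))"
    by (simp add: fun_eq_iff P_xmul_xmul)
  then have 2: "tensor_map (P (xmul r)) (V (outer r u)) (tensor_map (P (xmul (s - r))) a t) =
      tensor_map (P (xmul s)) (\<lambda>y. V (outer r u) (a y)) t"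
    using tensor_map_comp[OF X X clinear_V_outer[OF ur] a, of "monomial r" "monomial (s - r)" t]
    by simp
  show ?thesis unfolding F_vfield[OF ur] 1 2 ..
qed

text \<open>
  Commutation of \<open>E\<^sub>i\<^sub>j\<^sup>2\<close> with \<open>M = n (E\<^sub>i\<^sub>i - E\<^sub>j\<^sub>j) - E\<^sub>i\<^sub>j + N\<close>: by \<open>[E\<^sub>i\<^sub>i - E\<^sub>j\<^sub>j, E\<^sub>i\<^sub>j] = 2 E\<^sub>i\<^sub>j\<close> the first summand
  contributes \<open>4 n E\<^sub>i\<^sub>j\<^sup>2\<close>, and \<open>E\<^sub>i\<^sub>j\<close> contributes nothing.
\<close>

lemma bracket_square:
  assumes ij: "i \<noteq> j"
    and M: "M = of_int n *\<^sub>C (elem_matrix i i - elem_matrix j j) - elem_matrix i j + N" and N: "N \<in> sl"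
  shows "V M (V (elem_matrix i j) (V (elem_matrix i j) y)) - V (elem_matrix i j) (V (elem_matrix i j) (V M y))
    = (4 * of_int n) *\<^sub>C V (elem_matrix i j) (V (elem_matrix i j) y)
      + (V N (V (elem_matrix i j) (V (elem_matrix i j) y)) - V (elem_matrix i j) (V (elem_matrix i j) (V N y)))"
proof -
  let ?H = "elem_matrix i i - elem_matrix j j" and ?E = "V (elem_matrix i j)"
  have sl: "?H \<in> sl" "elem_matrix i j \<in> sl" "of_int n *\<^sub>C ?H \<in> sl" "of_int n *\<^sub>C ?H - elem_matrix i j \<in> sl"
    using ij sl_closed elem_matrix_in_sl[OF ij] elem_matrix_diag_in_sl[of i j]
      sl_closed(1)[OF sl_closed(2)[OF elem_matrix_diag_in_sl[of i j]] sl_closed(2)[OF elem_matrix_in_sl[OF ij]], of _ "-1"]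
    by auto
  have "matrix_bracket ?H (elem_matrix i j) = 2 *\<^sub>C elem_matrix i j"
    using ij
    by (simp add: matrix_bracket_def matrix_diff_mult elem_matrix_mult scaleC_2)
  then have H: "V ?H (?E y) = ?E (V ?H y) + 2 *\<^sub>C ?E y" for y
    using V_bracket[OF sl(1,2), of y] by (simp add: V_scaleC sl algebra_simps)
  have "V M y = of_int n *\<^sub>C V ?H y - ?E y + V N y" for y
    unfolding M by (simp only: V_add V_diff V_scaleC sl N)
  then show ?thesis
    using clinear_V[OF sl(2)]
    by (simp add: H clinear_add clinear_diff clinear_scaleC scaleC_add_right scaleC_scaleC
        complex_vector.scale_right_diff_distrib)
      (simp add: algebra_simps flip: scaleC_add_left)
qed

end

context tensor_intertwiner
begin

lemma intertwines_cancel: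
  assumes X: "X \<in> weyl_algebra" and a: "clinear a" "clinear a'" and b: "clinear b" "clinear b'"
    and c: "c \<noteq> 0" and "intertwines X (\<lambda>y. c *\<^sub>C a y + b y) (\<lambda>y. c *\<^sub>C a' y + b' y)"
    and "intertwines X b b'"
  shows "intertwines X a a'"
proof -
  have "c *\<^sub>C \<phi> (tensor_map (P X) a t) = c *\<^sub>C tensor_map (P' X) a' (\<phi> t)" for t
    using assms
    by (simp add: intertwines_def tensor_map_lincomb_right A.clinear_P B.clinear_P
        clinear_add[OF \<phi>] clinear_scaleC[OF \<phi>])
  then show ?thesis using c by (simp add: intertwines_def)
qed

text \<open>
  For \<open>s\<^sub>j = 0\<close> this is \<open>intertwines_square\<close> with \<open>r = e\<^sub>i\<close> and \<open>u = e\<^sub>j\<close>. Otherwise put \<open>n = s\<^sub>j\<close>. For any integer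
  \<open>d\<close>, the vectors \<open>t = d e\<^sub>i + n e\<^sub>j\<close> and \<open>w = n e\<^sub>i - d e\<^sub>j\<close> are orthogonal and \<open>(s - t)\<^sub>j = 0\<close>, so commuting
  \<open>x\<^bsup>s - t\<^esup> \<otimes> E\<^sub>i\<^sub>j\<^sup>2\<close> with \<open>D(w, t)\<close> shows that \<open>x\<^sup>s \<otimes> (n (s\<^sub>i - d) E\<^sub>i\<^sub>j\<^sup>2 + [t w\<^sup>T, E\<^sub>i\<^sub>j\<^sup>2])\<close> is intertwined. The
  bracket depends on \<open>d\<close> only through \<open>4 n d E\<^sub>i\<^sub>j\<^sup>2\<close>, whence the difference of the cases \<open>d = 1\<close> and \<open>d = 0\<close> is
  \<open>3 n x\<^sup>s \<otimes> E\<^sub>i\<^sub>j\<^sup>2\<close>.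
\<close>

lemma absorbed_square:
  assumes ij: "i \<noteq> j"
  shows "absorbed (\<lambda>y. V (elem_matrix i j) (V (elem_matrix i j) y))
    (\<lambda>y. V' (elem_matrix i j) (V' (elem_matrix i j) y))"
    (is "absorbed ?a ?a'")
proof -
  note E = elem_matrix_in_sl[OF ij]
  have a: "clinear ?a" "clinear ?a'"
    using clinear_comp[OF A.clinear_V[OF E] A.clinear_V[OF E]]
      clinear_comp[OF B.clinear_V[OF E] B.clinear_V[OF E]] .
  have zero: "intertwines (xmul s) ?a ?a'" if "s $ j = 0" for s
    using intertwines_square[of "axis j 1" "axis i 1" s] that ij
    by (simp add: outer_axis pairing_axis axis_nth)
  have "intertwines (xmul s) ?a ?a'" for s
  proof (cases "s $ j = 0")
    case False
    define n where "n = s $ j"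
    define t where "t d = axis i d + axis j n" for d :: int
    define w :: "int \<Rightarrow> complex ^ 'n" where "w d = axis i (of_int n) + axis j (- of_int d)" for d
    define br where "br d y = V (outer (t d) (w d)) (?a y) - ?a (V (outer (t d) (w d)) y)" for d y
    define br' where "br' d y = V' (outer (t d) (w d)) (?a' y) - ?a' (V' (outer (t d) (w d)) y)" for d y
    have orth: "pairing (w d) (t d) = 0" for d
      using ij by (simp add: w_def t_def pairing_add pairing_axis axis_nth)
    have pair: "pairing (w d) (s - t d) = of_int (n * (s $ i - d))" for d
      using ij by (simp add: w_def t_def pairing_add pairing_axis axis_nth n_def)
    have int: "intertwines (xmul s)
        (\<lambda>y. of_int (n * (s $ i - d)) *\<^sub>C ?a y + br d y) (\<lambda>y. of_int (n * (s $ i - d)) *\<^sub>C ?a' y + br' d y)" for d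
    proof -
      have "(s - t d) $ j = 0" using ij by (simp add: t_def axis_nth n_def)
      from intertwines_bracket[OF orth[of d] a zero[OF this]]
      show ?thesis by (simp add: pair br_def br'_def)
    qed
    have M: "outer (t 1) (w 1) =
        of_int n *\<^sub>C (elem_matrix i i - elem_matrix j j) - elem_matrix i j + outer (t 0) (w 0)"
      using ij by (auto simp: vec_eq_iff outer_def t_def w_def axis_nth elem_matrix_def scaleC_vec_def
          scaleC_complex_def)
    have N: "outer (t 0) (w 0) \<in> sl" by (rule outer_in_sl[OF orth])
    have shift: "of_int (n * (s $ i - 1)) *\<^sub>C x + ((4 * of_int n) *\<^sub>C x + z)
        = (3 * of_int n) *\<^sub>C x + (of_int (n * (s $ i - 0)) *\<^sub>C x + z)" for x z :: "'z::complex_vector"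
    proof -
      have merge: "c *\<^sub>C x + (d *\<^sub>C x + z) = (c + d) *\<^sub>C x + z" for c d
        by (simp only: scaleC_add_left add.assoc)
      show ?thesis
        unfolding merge by (rule arg_cong[where f = "\<lambda>c. c *\<^sub>C x + z"]) (simp add: algebra_simps)
    qed
    have br: "br 1 y = (4 * of_int n) *\<^sub>C ?a y + br 0 y" "br' 1 y' = (4 * of_int n) *\<^sub>C ?a' y' + br' 0 y'" for y y'
      unfolding br_def br'_def
      by (rule A.bracket_square[OF ij M N] B.bracket_square[OF ij M N])+
    have cl: "clinear (\<lambda>y. of_int (n * (s $ i - 0)) *\<^sub>C ?a y + br 0 y)"
        "clinear (\<lambda>y. of_int (n * (s $ i - 0)) *\<^sub>C ?a' y + br' 0 y)"
      unfolding br_def br'_def using a A.clinear_V[OF N] B.clinear_V[OF N]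
      by (auto intro!: clinearI simp: clinear_add[OF a(1)] clinear_add[OF a(2)] clinear_scaleC[OF a(1)]
          clinear_scaleC[OF a(2)] clinear_add clinear_scaleC scaleC_add_right scaleC_scaleC
          complex_vector.scale_right_diff_distrib mult.commute)
    show ?thesis
    proof (rule intertwines_cancel[OF weyl_algebra.mult a cl _ _ int])
      show "3 * complex_of_int n \<noteq> 0" using False by (simp add: n_def)
      show "intertwines (xmul s)
          (\<lambda>y. (3 * of_int n) *\<^sub>C ?a y + (of_int (n * (s $ i - 0)) *\<^sub>C ?a y + br 0 y))
          (\<lambda>y. (3 * of_int n) *\<^sub>C ?a' y + (of_int (n * (s $ i - 0)) *\<^sub>C ?a' y + br' 0 y))"
        using int[of 1] unfolding br shift .
    qed
  qed (rule zero)
  then show ?thesis using a by (simp add: absorbed_def)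
qed

text \<open>
  For \<open>A = r u\<^sup>T\<close> compose \<open>D(u, r) = D(u, r) \<otimes> 1 + x\<^sup>r \<otimes> A\<close> with \<open>x\<^bsup>s - r\<^esup> \<otimes> a\<close>. The first summand yields
  \<open>X \<otimes> a\<close> with \<open>X\<close> in the Weyl algebra, which is intertwined, so the second one is intertwined as well.
\<close>

lemma absorbed_left:
  assumes abs: "absorbed a a'" and A: "A \<in> sl"
  shows "absorbed (\<lambda>y. V A (a y)) (\<lambda>y. V' A (a' y))"
  using A
proof (induction rule: sl_outer_induct)
  case (outer u r)
  have a: "clinear a" "clinear a'" using abs by (simp_all add: absorbed_def)
  have "intertwines (xmul s) (\<lambda>y. V (outer r u) (a y)) (\<lambda>y. V' (outer r u) (a' y))" for s
    unfolding intertwines_def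
  proof
    fix t
    let ?X = "vfield u r \<circ> xmul (s - r)"
    have X: "?X \<in> weyl_algebra" by (intro weyl_algebra.intros vfield_in_weyl)
    have A: "F_action P V (vfield u r) (tensor_map (P (xmul (s - r))) a t) =
        tensor_map (P ?X) a t + tensor_map (P (xmul s)) (\<lambda>y. V (outer r u) (a y)) t"
      by (rule A.F_vfield_tensor_map[OF outer a(1)])
    have B: "F_action P' V' (vfield u r) (tensor_map (P' (xmul (s - r))) a' (\<phi> t)) =
        tensor_map (P' ?X) a' (\<phi> t) + tensor_map (P' (xmul s)) (\<lambda>y. V' (outer r u) (a' y)) (\<phi> t)"
      by (rule B.F_vfield_tensor_map[OF outer a(2)])
    have "\<phi> (tensor_map (P (xmul (s - r))) a t) = tensor_map (P' (xmul (s - r))) a' (\<phi> t)"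
      "\<phi> (tensor_map (P ?X) a t) = tensor_map (P' ?X) a' (\<phi> t)"
      using intertwines_weyl[OF abs X] intertwines_weyl[OF abs weyl_algebra.mult]
      unfolding intertwines_def by blast+
    then show "\<phi> (tensor_map (P (xmul s)) (\<lambda>y. V (outer r u) (a y)) t) =
        tensor_map (P' (xmul s)) (\<lambda>y. V' (outer r u) (a' y)) (\<phi> t)"
      using arg_cong[OF A, of \<phi>] B by (simp add: \<phi>_vfield outer clinear_add[OF \<phi>])
  qed
  then show ?case
    using clinear_comp[OF A.clinear_V_outer[OF outer] a(1)] clinear_comp[OF B.clinear_V_outer[OF outer] a(2)]
    by (simp add: absorbed_def)
next
  case (lincomb c A B)
  then have "absorbed (\<lambda>y. c *\<^sub>C V A (a y) + V B (a y)) (\<lambda>y. c *\<^sub>C V' A (a' y) + V' B (a' y))"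
    by (intro absorbed_lincomb)
  then show ?case
    using lincomb by (simp add: A.V_add B.V_add A.V_scaleC B.V_scaleC sl_closed)
qed

text \<open>
  The vectors \<open>a y\<close> with \<open>a\<close> absorbed span \<open>V\<close>, since their span is a nonzero submodule. On \<open>z \<otimes> a y\<close>,
  an operator \<open>X \<otimes> b\<close> acts like \<open>X \<otimes> b a\<close> on \<open>z \<otimes> y\<close>, and \<open>1 \<otimes> a\<close> itself is intertwined.
\<close>

lemma intertwines_if_absorbed:
  assumes irr: "irreducible_action sl V" and nz: "absorbed a0 a0'" "a0 y0 \<noteq> 0"
    and X: "X \<in> weyl_algebra" and b: "clinear b" "clinear b'"
    and int: "\<And>a a'. absorbed a a' \<Longrightarrow> intertwines X (\<lambda>y. b (a y)) (\<lambda>y. b' (a' y))"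
  shows "intertwines X b b'"
proof -
  let ?S = "{v. \<exists>a a' y. absorbed a a' \<and> v = a y}"
  let ?U = "complex_vector.span ?S"
  have "submodule sl V ?U"
    unfolding submodule_def
  proof (intro conjI ballI)
    show "V A v \<in> ?U" if A: "A \<in> sl" and v: "v \<in> ?U" for A v
      using v
    proof (induction rule: complex_vector.span_induct_alt)
      case base
      show ?case using clinear_0[OF A.clinear_V[OF A]] complex_vector.span_zero by simp
    next
      case (step c x y)
      then obtain a a' y1 where x: "x = a y1" and abs: "absorbed a a'"
        by (elim CollectE exE conjE)
      have "V A x \<in> ?S"
        by (intro CollectI exI conjI, rule absorbed_left[OF abs A]) (simp add: x)
      then show ?case
        using step(2)
        by (simp add: clinear_add[OF A.clinear_V[OF A]] clinear_scaleC[OF A.clinear_V[OF A]]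
            complex_vector.span_add complex_vector.span_scale complex_vector.span_base)
    qed
  qed (rule complex_vector.subspace_span)
  moreover have "?U \<noteq> {0}"
  proof -
    have "a0 y0 \<in> ?U" by (rule complex_vector.span_base) (use nz(1) in blast)
    then show ?thesis using nz(2) by blast
  qed
  ultimately have U: "?U = UNIV" using irr by (auto simp: irreducible_action_def)
  have PX: "clinear (P X)" "clinear (P' X)" by (simp_all add: A.clinear_P B.clinear_P X)
  have T: "clinear (tensor_map (P X) b)" "clinear (tensor_map (P' X) b')"
    using PX b by (simp_all add: clinear_tensor_map)
  have pure: "\<phi> (tensor_map (P X) b (z \<otimes>\<^sub>C y)) = tensor_map (P' X) b' (\<phi> (z \<otimes>\<^sub>C y))" for z y
  proof -
    have "y \<in> ?U" using U by blast
    then show ?thesis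
    proof (induction rule: complex_vector.span_induct_alt)
      case base
      show ?case by (simp add: pure_tensor_0_right clinear_0[OF \<phi>] clinear_0[OF T(1)] clinear_0[OF T(2)])
    next
      case (step c x y)
      then obtain a a' y1 where x: "x = a y1" and abs: "absorbed a a'"
        by (elim CollectE exE conjE)
      have a: "clinear a" "clinear a'" using abs by (simp_all add: absorbed_def)
      have 0: "P (xmul 0) z = z" "P' (xmul 0) = id"
        by (simp_all add: A.P_xmul_0 B.P_xmul_0)
      have "\<phi> (tensor_map (P X) b (z \<otimes>\<^sub>C x)) = \<phi> (tensor_map (P X) (\<lambda>y. b (a y)) (z \<otimes>\<^sub>C y1))"
        using PX b clinear_comp[OF b(1) a(1)] by (simp add: tensor_map_pure x)
      also have "\<dots> = tensor_map (P' X) (\<lambda>y. b' (a' y)) (\<phi> (z \<otimes>\<^sub>C y1))"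
        using int[OF abs] by (simp add: intertwines_def)
      also have "\<dots> = tensor_map (P' X) b' (tensor_map id a' (\<phi> (z \<otimes>\<^sub>C y1)))"
        using tensor_map_comp[OF PX(2) clinear_id b(2) a(2)] by simp
      also have "tensor_map id a' (\<phi> (z \<otimes>\<^sub>C y1)) = \<phi> (tensor_map (P (xmul 0)) a (z \<otimes>\<^sub>C y1))"
        using intertwines_weyl[OF abs weyl_algebra.mult, of "monomial 0"] 0
        by (simp add: intertwines_def)
      also have "tensor_map (P (xmul 0)) a (z \<otimes>\<^sub>C y1) = z \<otimes>\<^sub>C x"
        by (simp add: tensor_map_pure A.clinear_P weyl_algebra.mult a 0 x)
      finally show ?case
        using step(2)
        by (simp add: pure_tensor_add_right pure_tensor_scaleC_right clinear_add[OF \<phi>]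
            clinear_scaleC[OF \<phi>] clinear_add[OF T(1)] clinear_add[OF T(2)]
            clinear_scaleC[OF T(1)] clinear_scaleC[OF T(2)])
    qed
  qed
  show ?thesis
    unfolding intertwines_def
  proof
    fix t
    show "\<phi> (tensor_map (P X) b t) = tensor_map (P' X) b' (\<phi> t)"
      by (induction t rule: tensor_induct)
        (simp_all add: pure clinear_add[OF \<phi>] clinear_add[OF T(1)] clinear_add[OF T(2)])
  qed
qed

end

section \<open>Modules on which root vectors square to zero\<close>

lemma position_less_iff: "position i < position j \<longleftrightarrow> i < (j :: 'n::{finite,linorder})"
proof -
  have less: "position i < position j" if "i < j" for i j :: 'n
    unfolding position_def by (rule psubset_card_mono) (use that in auto)
  show ?thesis using less[of i j] less[of j i] by (cases i j rule: linorder_cases) auto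
qed

lemma position_le_iff: "position i \<le> position j \<longleftrightarrow> i \<le> (j :: 'n::{finite,linorder})"
  using position_less_iff[of j i] by (simp add: linorder_not_less[symmetric])

lemma position_eq_iff: "position i = position j \<longleftrightarrow> i = (j :: 'n::{finite,linorder})"
  by (simp add: eq_iff position_le_iff)

lemma position_pos: "0 < position (i :: 'n::{finite,linorder})"
  unfolding position_def by (auto simp: card_gt_0_iff)

lemma position_le_card: "position (i :: 'n::{finite,linorder}) \<le> CARD('n)"
  unfolding position_def by (rule card_mono) auto

text \<open>The value of the root \<open>\<epsilon>\<^sub>a - \<epsilon>\<^sub>b\<close>, which belongs to \<open>E\<^sub>a\<^sub>b\<close>, on \<open>E\<^sub>i\<^sub>i - E\<^sub>j\<^sub>j\<close>.\<close>

definition root_value :: "'n \<Rightarrow> 'n \<Rightarrow> 'n \<Rightarrow> 'n \<Rightarrow> int" where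
  "root_value a b i j = of_bool (i = a) - of_bool (i = b) - of_bool (j = a) + of_bool (j = b)"

lemma bracket_diag_elem_matrix:
  "matrix_bracket (elem_matrix i i - elem_matrix j j) (elem_matrix a b) =
    of_int (root_value a b i j) *\<^sub>C elem_matrix a b"
  by (auto simp: matrix_bracket_def matrix_diff_mult elem_matrix_mult root_value_def scaleC_2)

lemma bracket_diag_diag:
  "matrix_bracket (elem_matrix i i - elem_matrix j j) (elem_matrix k k - elem_matrix l l) = 0"
  by (auto simp: matrix_bracket_def matrix_diff_mult elem_matrix_mult)

lemma bracket_elem_matrix:
  "i \<noteq> j \<Longrightarrow> matrix_bracket (elem_matrix i j) (elem_matrix j i) = elem_matrix i i - elem_matrix j j"
  by (simp add: matrix_bracket_def elem_matrix_mult)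

text \<open>
  The argument \<open>m\<close> gives the values \<open>m i j\<close> of a weight on \<open>E\<^sub>i\<^sub>i - E\<^sub>j\<^sub>j\<close>. This is a linear functional
  on weights that is positive on the positive roots; averaging over \<open>j\<close> is a way to weigh the \<open>i\<close>-th
  coordinate of a weight although only differences of coordinates are given.
\<close>

definition height :: "('n::{finite,linorder} \<Rightarrow> 'n \<Rightarrow> int) \<Rightarrow> int" where
  "height m = - (\<Sum>i\<in>UNIV. \<Sum>j\<in>UNIV. int (position i) * m i j)"

lemma height_add_root:
  fixes a b :: "'n::{finite,linorder}"
  shows "height (\<lambda>i j. m i j + root_value a b i j) =
    height m + int CARD('n) * (int (position b) - int (position a))"
  by (simp add: height_def root_value_def ring_distribs sum.distrib sum_subtractf
      of_bool_def if_distrib[where f = "\<lambda>x. _ * x"] sum.delta cong: if_cong)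

definition height_bound :: "'n::{finite,linorder} itself \<Rightarrow> int" where
  "height_bound _ = (\<Sum>i\<in>UNIV. \<Sum>j\<in>(UNIV :: 'n set). int (position (i :: 'n)))"

lemma height_bound:
  fixes m :: "'n::{finite,linorder} \<Rightarrow> 'n \<Rightarrow> int"
  assumes "\<And>i j. m i j \<in> {-1, 0, 1}"
  shows "\<bar>height m\<bar> \<le> height_bound TYPE('n)"
proof -
  have "\<bar>height m\<bar> \<le> (\<Sum>i\<in>UNIV. \<bar>\<Sum>j\<in>UNIV. int (position i) * m i j\<bar>)"
    unfolding height_def abs_minus_cancel by (rule sum_abs)
  also have "\<dots> \<le> (\<Sum>i\<in>UNIV. \<Sum>j\<in>UNIV. \<bar>int (position i) * m i j\<bar>)"
    by (intro sum_mono sum_abs)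
  also have "\<dots> \<le> height_bound TYPE('n)"
    unfolding height_bound_def
  proof (intro sum_mono)
    show "\<bar>int (position i) * m i j\<bar> \<le> int (position i)" for i j
      using assms[of i j] by auto
  qed
  finally show ?thesis .
qed

locale square_zero_module = sl_module V
  for V :: "'n::{finite,linorder} sqmatrix \<Rightarrow> 'v::complex_vector \<Rightarrow> 'v" +
  assumes square_zero: "i \<noteq> j \<Longrightarrow> V (elem_matrix i j) (V (elem_matrix i j) y) = 0"
begin

abbreviation "E i j \<equiv> V (elem_matrix i j)"
abbreviation "H i j \<equiv> V (elem_matrix i i - elem_matrix j j)"

lemma clinear_E: "i \<noteq> j \<Longrightarrow> clinear (E i j)"
  by (simp add: clinear_V elem_matrix_in_sl)

lemma clinear_H: "clinear (H i j)"
  by (simp add: clinear_V elem_matrix_diag_in_sl)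

lemma H_E:
  assumes "a \<noteq> b"
  shows "H i j (E a b y) = E a b (H i j y) + of_int (root_value a b i j) *\<^sub>C E a b y"
  using V_bracket[OF elem_matrix_diag_in_sl elem_matrix_in_sl[OF assms], of i j y]
  by (simp add: bracket_diag_elem_matrix V_scaleC elem_matrix_in_sl assms algebra_simps)

lemma H_commute: "H i j (H k l y) = H k l (H i j y)"
  using V_bracket[OF elem_matrix_diag_in_sl elem_matrix_diag_in_sl, of i j k l y]
  by (simp add: bracket_diag_diag V_0)

lemma E_F:
  assumes "i \<noteq> j"
  shows "E i j (E j i y) = H i j y + E j i (E i j y)"
  using V_bracket[OF elem_matrix_in_sl[OF assms] elem_matrix_in_sl[OF assms[symmetric]], of y]
  by (simp add: bracket_elem_matrix assms algebra_simps)

lemma H_swap: "H j i y = - H i j y"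
  using V_minus[OF elem_matrix_diag_in_sl[of i j]] by simp

text \<open>
  Expanding \<open>0 = e e f\<close> in an \<open>sl\<^sub>2\<close>-triple with \<open>e\<^sup>2 = 0\<close> gives \<open>e h + h e = 0\<close>; combined with
  \<open>h e - e h = 2 e\<close> this is \<open>h e = e\<close>.
\<close>

lemma H_E_same:
  assumes ij: "i \<noteq> j"
  shows "H i j (E i j y) = E i j y"
proof -
  have "0 = E i j (E i j (E j i y))" by (simp add: square_zero ij)
  also have "\<dots> = E i j (H i j y) + H i j (E i j y)"
    by (simp add: E_F ij clinear_add[OF clinear_E[OF ij]] square_zero
        clinear_0[OF clinear_E[OF ij[symmetric]]])
  also have "E i j (H i j y) = H i j (E i j y) - 2 *\<^sub>C E i j y"
    using ij by (simp add: H_E root_value_def)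
  finally have "2 *\<^sub>C H i j (E i j y) = 2 *\<^sub>C E i j y"
    by (simp add: scaleC_2 algebra_simps)
  then show ?thesis by simp
qed

lemma H_F_same: "i \<noteq> j \<Longrightarrow> H i j (E j i y) = - E j i y"
  using H_E_same[of j i y] H_swap[of i j "E j i y"] by simp

lemma H_H: "i \<noteq> j \<Longrightarrow> H i j (H i j y) = E i j (E j i y) + E j i (E i j y)"
proof -
  assume ij: "i \<noteq> j"
  have "H i j y = E i j (E j i y) - E j i (E i j y)" by (simp add: E_F ij)
  then have "H i j (H i j y) = H i j (E i j (E j i y) - E j i (E i j y))" by (rule arg_cong)
  also have "\<dots> = E i j (E j i y) + E j i (E i j y)"
    by (simp only: clinear_diff[OF clinear_H] H_E_same[OF ij] H_F_same[OF ij] diff_minus_eq_add)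
  finally show ?thesis .
qed

text \<open>From \<open>h = e f - f e\<close>, \<open>h e = e\<close> and \<open>h f = - f\<close>.\<close>

lemma H_cubed: "H i j (H i j (H i j y)) = H i j y"
proof (cases "i = j")
  case False
  have "H i j (H i j (H i j y)) = E i j (E j i y) - E j i (E i j y)"
    by (simp only: H_H[OF False] clinear_add[OF clinear_H] H_E_same[OF False] H_F_same[OF False]
        add_uminus_conv_diff)
  then show ?thesis by (simp add: E_F False)
qed (simp add: V_0)

definition weight_vector :: "('n \<Rightarrow> 'n \<Rightarrow> int) \<Rightarrow> 'v \<Rightarrow> bool" where
  "weight_vector m v \<longleftrightarrow> v \<noteq> 0 \<and> (\<forall>i j. H i j v = of_int (m i j) *\<^sub>C v)"

lemma eigenvalue_range:
  assumes "v \<noteq> 0" "H i j v = \<mu> *\<^sub>C v"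
  shows "\<mu> \<in> {-1, 0, 1}"
proof -
  have "(\<mu> * (\<mu> * \<mu>)) *\<^sub>C v = \<mu> *\<^sub>C v"
    using H_cubed[of i j v] by (simp add: assms clinear_scaleC[OF clinear_H] scaleC_scaleC)
  then have "\<mu> * ((\<mu> + 1) * (\<mu> - 1)) = 0"
    using assms(1) by (simp add: algebra_simps)
  then show ?thesis by (auto simp: add_eq_0_iff2)
qed

lemma weight_range:
  assumes "weight_vector m v"
  shows "m i j \<in> {-1, 0, 1}"
proof -
  have "complex_of_int (m i j) \<in> {of_int (-1), of_int 0, of_int 1}"
    using eigenvalue_range[of v i j "of_int (m i j)"] assms by (simp add: weight_vector_def)
  then show ?thesis by (simp only: insert_iff of_int_eq_iff empty_iff)
qed

text \<open>
  The commuting operators \<open>h = E\<^sub>i\<^sub>i - E\<^sub>j\<^sub>j\<close> are diagonalised one after the other: if \<open>v \<noteq> 0\<close>, then one of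
  its components \<open>v - h\<^sup>2 v\<close>, \<open>h\<^sup>2 v + h v\<close>, \<open>h\<^sup>2 v - h v\<close> for the eigenvalues \<open>0\<close>, \<open>1\<close>, \<open>-1\<close> of \<open>h\<close> is nonzero, and
  it is still an eigenvector of the operators treated before.
\<close>

lemma ex_weight_vector:
  assumes "(v0 :: 'v) \<noteq> 0"
  obtains m v where "weight_vector m v"
proof -
  have "\<exists>v. v \<noteq> 0 \<and> (\<forall>i j. (i, j) \<in> F \<longrightarrow> (\<exists>\<mu>. H i j v = \<mu> *\<^sub>C v))" if "finite F" for F
    using that
  proof induction
    case empty
    show ?case using assms by auto
  next
    case (insert p F)
    then obtain v where v: "v \<noteq> 0" "\<And>i j. (i, j) \<in> F \<Longrightarrow> \<exists>\<mu>. H i j v = \<mu> *\<^sub>C v" by auto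
    obtain k l where p: "p = (k, l)" by (cases p)
    define x y z where "x = v - H k l (H k l v)" and "y = H k l (H k l v) + H k l v"
      and "z = H k l (H k l v) - H k l v"
    have eig: "H k l x = 0 *\<^sub>C x" "H k l y = 1 *\<^sub>C y" "H k l z = (-1) *\<^sub>C z"
      by (simp_all add: x_def y_def z_def clinear_add[OF clinear_H] clinear_diff[OF clinear_H] H_cubed)
    have other: "\<exists>\<mu>. H i j w = \<mu> *\<^sub>C w" if "(i, j) \<in> F" "w \<in> {x, y, z}" for i j w
    proof -
      obtain \<mu> where "H i j v = \<mu> *\<^sub>C v" using v(2) \<open>(i, j) \<in> F\<close> by blast
      then have "H i j w = \<mu> *\<^sub>C w"
        using that(2)
        by (auto simp: x_def y_def z_def clinear_add[OF clinear_H] clinear_diff[OF clinear_H]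
            clinear_scaleC[OF clinear_H] H_commute[of i j] scaleC_add_right
            complex_vector.scale_right_diff_distrib)
      then show ?thesis by blast
    qed
    have "x \<noteq> 0 \<or> y \<noteq> 0 \<or> z \<noteq> 0"
    proof (rule ccontr)
      assume "\<not> ?thesis"
      then have 0: "x = 0" "y = 0" "z = 0" by auto
      have "y + z = 2 *\<^sub>C H k l (H k l v)" by (simp add: y_def z_def scaleC_2)
      then have "H k l (H k l v) = 0" using 0 by simp
      then show False using 0(1) v(1) by (simp add: x_def)
    qed
    then obtain w where w: "w \<noteq> 0" "w \<in> {x, y, z}" by blast
    then have "\<exists>\<mu>. H k l w = \<mu> *\<^sub>C w" using eig by blast
    then show ?case using w other p by (intro exI[of _ w]) auto
  qed
  from this[of UNIV] obtain v where v: "v \<noteq> 0" "\<And>i j. \<exists>\<mu>. H i j v = \<mu> *\<^sub>C v" by auto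
  have "\<exists>c :: int. H i j v = of_int c *\<^sub>C v" for i j
  proof -
    obtain \<mu> where \<mu>: "H i j v = \<mu> *\<^sub>C v" using v(2) by blast
    have "\<mu> \<in> {of_int (-1), of_int 0, of_int 1}" using eigenvalue_range[OF v(1) \<mu>] by simp
    then show ?thesis using \<mu> by blast
  qed
  then obtain m where "\<And>i j. H i j v = of_int (m i j :: int) *\<^sub>C v" by metis
  then show ?thesis using that v(1) by (auto simp: weight_vector_def)
qed

lemma weight_vector_E:
  assumes v: "weight_vector m v" and ab: "a \<noteq> b" and nz: "E a b v \<noteq> 0"
  shows "weight_vector (\<lambda>i j. m i j + root_value a b i j) (E a b v)"
  using v nz
  by (simp add: weight_vector_def H_E[OF ab] clinear_scaleC[OF clinear_E[OF ab]] scaleC_add_left)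

text \<open>
  The heights of weights are bounded, and \<open>E\<^sub>a\<^sub>b\<close> with \<open>a < b\<close> strictly increases the height; so it kills a
  weight vector of maximal height.
\<close>

lemma ex_highest_weight_vector:
  assumes "(v0 :: 'v) \<noteq> 0"
  obtains m v where "weight_vector m v" "\<And>a b. a < b \<Longrightarrow> E a b v = 0"
proof -
  let ?K = "height_bound TYPE('n)" and ?f = "\<lambda>m :: 'n \<Rightarrow> 'n \<Rightarrow> int. nat (height m + height_bound TYPE('n))"
  let ?Q = "\<lambda>m. \<exists>v. weight_vector m v"
  obtain m0 where m0: "?Q m0" using ex_weight_vector[OF assms] by blast
  have bound: "\<bar>height m\<bar> \<le> ?K" if "?Q m" for m
    using that weight_range by (intro height_bound) blast
  have "?f m < Suc (nat (2 * ?K))" if "?Q m" for m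
    using bound[OF that] by linarith
  then have "\<forall>m. ?Q m \<longrightarrow> ?f m < Suc (nat (2 * ?K))" by (intro allI impI)
  with m0 have "\<exists>m. ?Q m \<and> (\<forall>m'. ?Q m' \<longrightarrow> ?f m' \<le> ?f m)"
    by (rule ex_has_greatest_nat[of ?Q m0 ?f "Suc (nat (2 * ?K))"])
  then obtain m where m: "?Q m \<and> (\<forall>m'. ?Q m' \<longrightarrow> ?f m' \<le> ?f m)" ..
  have max: "?f m' \<le> ?f m" if "?Q m'" for m'
    using m that by blast
  obtain v where v: "weight_vector m v" using m by blast
  have "E a b v = 0" if ab: "a < b" for a b
  proof (rule ccontr)
    assume "E a b v \<noteq> 0"
    then have Q: "?Q (\<lambda>i j. m i j + root_value a b i j)"
      using weight_vector_E[OF v _ \<open>E a b v \<noteq> 0\<close>] ab by auto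
    have "0 < int CARD('n) * (int (position b) - int (position a))"
      using ab by (simp add: position_less_iff)
    then have "height m < height (\<lambda>i j. m i j + root_value a b i j)"
      by (simp add: height_add_root)
    then show False using max[OF Q] bound[OF Q] bound[OF conjunct1[OF m]] by linarith
  qed
  then show ?thesis using that v by blast
qed

text \<open>
  On a vector killed by \<open>e\<close>, \<open>h\<^sup>2 = e f = h\<close>, so a highest weight takes only the values \<open>0\<close> and \<open>1\<close> on the
  positive coroots. If it were \<open>1\<close> on two simple coroots, it would be at least \<open>2\<close> on the sum of all simple
  coroots from the one to the other, which is a coroot too.
\<close>

lemma highest_weight_is_fundamental:
  assumes v: "weight_vector m v" and hw: "\<And>a b. a < b \<Longrightarrow> E a b v = 0"
  obtains k where "k < CARD('n)" "highest_weight_vector V (fundamental_weight k) v"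
proof -
  have nz: "v \<noteq> 0" and H: "H i j v = of_int (m i j) *\<^sub>C v" for i j
    using v by (simp_all add: weight_vector_def)
  have m01: "m i j = 0 \<or> m i j = 1" if "i < j" for i j
  proof -
    have ij: "i \<noteq> j" using that by simp
    have "H i j (H i j v) = H i j v"
      using H_H[OF ij] E_F[OF ij] hw[OF that] clinear_0[OF clinear_E[OF ij[symmetric]]] by simp
    then have "of_int (m i j * m i j) *\<^sub>C v = complex_of_int (m i j) *\<^sub>C v"
      by (simp add: H clinear_scaleC[OF clinear_H] scaleC_scaleC)
    then have "complex_of_int (m i j * m i j) = of_int (m i j)"
      using nz complex_vector.scale_right_imp_eq by blast
    then have "m i j * m i j = m i j" by (simp only: of_int_eq_iff)
    then show ?thesis by simp
  qed
  have m_add: "m i j + m j k = m i k" for i j k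
  proof -
    have "H i k v = H i j v + H j k v"
      using V_add[OF elem_matrix_diag_in_sl[of i j] elem_matrix_diag_in_sl[of j k]] by simp
    then have "complex_of_int (m i k) *\<^sub>C v = complex_of_int (m i j + m j k) *\<^sub>C v"
      by (simp add: H scaleC_add_left)
    then have "complex_of_int (m i k) = of_int (m i j + m j k)"
      using nz complex_vector.scale_right_imp_eq by blast
    then show ?thesis by (simp only: of_int_eq_iff)
  qed
  have m_nonneg: "0 \<le> m i j" if "i \<le> j" for i j
    using m01[of i j] that m_add[of i i i] by (cases "i = j") (auto simp: less_le)
  have unique: "\<not> (j \<le> a \<and> m i j = 1 \<and> m a b = 1)" if "i < j" "a < b" for i j a b
  proof
    assume *: "j \<le> a \<and> m i j = 1 \<and> m a b = 1"
    have "m i b = m i j + (m j a + m a b)" by (simp add: m_add)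
    moreover have "i < b" using that * by auto
    ultimately show False using m01[of i b] m_nonneg[of j a] * by auto
  qed
  have "\<exists>k<CARD('n). \<forall>i j. position j = Suc (position i) \<longrightarrow>
      complex_of_int (m i j) = fundamental_weight k (position i)"
  proof (cases "\<exists>a b. position b = Suc (position a) \<and> m a b = 1")
    case False
    have "complex_of_int (m i j) = fundamental_weight 0 (position i)"
      if "position j = Suc (position i)" for i j
    proof -
      have "i < j" using that position_less_iff[of i j] by simp
      then show ?thesis
        using m01[of i j] False that position_pos[of i] by (auto simp: fundamental_weight_def)
    qed
    then show ?thesis by (intro exI[of _ 0]) auto
  next
    case True
    then obtain a b where ab: "position b = Suc (position a)" "m a b = 1" by blast
    then have less: "a < b" using position_less_iff[of a b] by simp
    have "complex_of_int (m i j) = fundamental_weight (position a) (position i)"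
      if ij: "position j = Suc (position i)" for i j
    proof -
      have ij_less: "i < j" using ij position_less_iff[of i j] by simp
      consider "i = a" | "position i < position a" | "position a < position i"
        using position_eq_iff[of i a] by linarith
      then show ?thesis
      proof cases
        case 1
        then have "j = b" using ij ab(1) position_eq_iff[of j b] by simp
        then show ?thesis using 1 ab by (simp add: fundamental_weight_def)
      next
        case 2
        then have "j \<le> a" using ij position_le_iff[of j a] by simp
        then show ?thesis
          using 2 unique[OF ij_less less] m01[OF ij_less] ab by (auto simp: fundamental_weight_def)
      next
        case 3
        then have "b \<le> i" using ab position_le_iff[of b i] by simp
        then show ?thesis
          using 3 unique[OF less ij_less] m01[OF ij_less] ab by (auto simp: fundamental_weight_def)
      qed
    qed
    moreover have "position a < CARD('n)" using ab(1) position_le_card[of b] by simp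
    ultimately show ?thesis by blast
  qed
  then obtain k where k: "k < CARD('n)" "\<And>i j. position j = Suc (position i) \<Longrightarrow>
      complex_of_int (m i j) = fundamental_weight k (position i)" by blast
  then have "highest_weight_vector V (fundamental_weight k) v"
    using nz hw by (simp add: highest_weight_vector_def H)
  then show ?thesis using that k(1) by blast
qed

text \<open>The images of \<open>v\<close> under words of length \<open>l\<close> in the lowering operators.\<close>

primrec lower :: "'v \<Rightarrow> nat \<Rightarrow> 'v set" where
  "lower v 0 = {v}"
| "lower v (Suc l) = (\<Union>a. \<Union>b\<in>{b. b < a}. E a b ` lower v l)"

lemma finite_lower: "finite (lower v l)"
  by (induction l) auto

lemma lower_height:
  assumes v: "weight_vector m v" and "w \<in> lower v l" "w \<noteq> 0"
  shows "\<exists>m'. weight_vector m' w \<and> height m' \<le> height m - int l"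
  using assms(2,3)
proof (induction l arbitrary: w)
  case 0
  then show ?case using v by auto
next
  case (Suc l)
  then obtain a b w' where w': "b < a" "w' \<in> lower v l" "w = E a b w'" by auto
  then have ab: "a \<noteq> b" by simp
  have "w' \<noteq> 0" using Suc.prems(2) w'(3) clinear_0[OF clinear_E[OF ab]] by auto
  then obtain m' where m': "weight_vector m' w'" "height m' \<le> height m - int l"
    using Suc.IH[OF w'(2)] by blast
  have "int CARD('n) * (int (position b) - int (position a)) \<le> 1 * (int (position b) - int (position a))"
    using w'(1) position_less_iff[of b a] by (intro mult_right_mono_neg) auto
  also have "\<dots> \<le> -1"
    using w'(1) position_less_iff[of b a] by simp
  finally have "height (\<lambda>i j. m' i j + root_value a b i j) \<le> height m - int l + (-1)"
    unfolding height_add_root by (rule add_mono[OF m'(2)])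
  then have "height (\<lambda>i j. m' i j + root_value a b i j) \<le> height m - int (Suc l)"
    by simp
  then show ?case using weight_vector_E[OF m'(1) ab] Suc.prems(2) w'(3) by blast
qed

text \<open>
  Long words in the lowering operators kill the highest weight vector, because the heights of weights are
  bounded from below. Hence finitely many words suffice to span the submodule that it generates. That the
  span of all words is a submodule follows by induction on the length of the word, moving \<open>A \<in> sl\<^sub>n\<close> past
  its first letter.
\<close>

lemma finite_dimensional:
  assumes irr: "irreducible_action sl V" and v: "weight_vector m v"
    and hw: "\<And>a b. a < b \<Longrightarrow> E a b v = 0"
  shows "\<exists>B. finite B \<and> complex_vector.span B = (UNIV :: 'v set)"
proof -
  define N where "N = nat (2 * height_bound TYPE('n))"
  define B where "B = (\<Union>l\<le>N. lower v l)"
  let ?W = "complex_vector.span B"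
  have lower_W: "w \<in> ?W" if w: "w \<in> lower v l" for w l
  proof (cases "w = 0 \<or> l \<le> N")
    case True
    then show ?thesis
      using w complex_vector.span_zero by (auto simp: B_def intro: complex_vector.span_base)
  next
    case False
    then obtain m' where m': "weight_vector m' w" "height m' \<le> height m - int l"
      using lower_height[OF v w] by blast
    have "\<bar>height m\<bar> \<le> height_bound TYPE('n)" "\<bar>height m'\<bar> \<le> height_bound TYPE('n)"
      using weight_range[OF v] weight_range[OF m'(1)] by (intro height_bound; blast)+
    then have False using m'(2) False unfolding N_def by linarith
    then show ?thesis ..
  qed
  have span_invariant: "V A w \<in> ?W" if A: "A \<in> sl" and base: "\<And>b l. b \<in> lower v l \<Longrightarrow> V A b \<in> ?W"
    and w: "w \<in> ?W" for A w
    using w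
  proof (induction rule: complex_vector.span_induct_alt)
    case base
    show ?case using clinear_0[OF clinear_V[OF A]] complex_vector.span_zero by simp
  next
    case (step c x y)
    then have "V A x \<in> ?W" using base by (auto simp: B_def)
    then show ?case
      using step(2) by (simp add: clinear_add[OF clinear_V[OF A]] clinear_scaleC[OF clinear_V[OF A]]
          complex_vector.span_add complex_vector.span_scale)
  qed
  have E_W: "E a b w \<in> ?W" if "b < a" "w \<in> ?W" for a b w
  proof (rule span_invariant)
    show "E a b x \<in> ?W" if "x \<in> lower v l" for x l
      using that \<open>b < a\<close> by (intro lower_W[of _ "Suc l"]) auto
  qed (use that in \<open>auto simp: elem_matrix_in_sl\<close>)
  have "V A w \<in> ?W" if "A \<in> sl" "w \<in> lower v l" for A w l
    using that
  proof (induction l arbitrary: A w)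
    case 0
    then have w: "w = v" by simp
    have vW: "v \<in> ?W" using lower_W[of v 0] by simp
    show ?case
      unfolding w using 0(1)
    proof (induction rule: sl_induct)
      case (off_diag i j)
      then show ?case
        using hw[of i j] E_W[OF _ vW, of j i] complex_vector.span_zero
        by (cases i j rule: linorder_cases) auto
    next
      case (diag i j)
      have "H i j v = of_int (m i j) *\<^sub>C v" using v by (simp add: weight_vector_def)
      then show ?case using vW by (simp add: complex_vector.span_scale)
    next
      case (lincomb c A B)
      then show ?case
        by (simp add: V_add V_scaleC sl_closed complex_vector.span_add complex_vector.span_scale)
    qed
  next
    case (Suc l)
    then obtain a b w' where w': "b < a" "w' \<in> lower v l" "w = E a b w'" by auto
    have ab: "elem_matrix a b \<in> sl" using w'(1) by (intro elem_matrix_in_sl) auto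
    have "V A w = E a b (V A w') + V (matrix_bracket A (elem_matrix a b)) w'"
      using V_bracket[OF Suc.prems(1) ab, of w'] w'(3) by simp
    moreover have "E a b (V A w') \<in> ?W"
      by (intro E_W w' Suc.IH Suc.prems)
    moreover have "V (matrix_bracket A (elem_matrix a b)) w' \<in> ?W"
      by (intro Suc.IH w' sl_closed)
    ultimately show ?case by (simp add: complex_vector.span_add)
  qed
  then have "submodule sl V ?W"
    unfolding submodule_def using span_invariant complex_vector.subspace_span by blast
  moreover have "v \<in> ?W" "v \<noteq> 0"
    using lower_W[of v 0] v by (simp_all add: weight_vector_def)
  ultimately have "?W = UNIV" using irr unfolding irreducible_action_def by blast
  moreover have "finite B" by (simp add: B_def finite_lower)
  ultimately show ?thesis by blast
qed

lemma is_V_delta: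
  assumes irr: "irreducible_action sl V"
  shows "\<exists>k<CARD('n). is_V_delta k V"
proof -
  obtain v0 :: 'v where v0: "v0 \<noteq> 0" using irr by (auto simp: irreducible_action_def)
  obtain m v where v: "weight_vector m v" "\<And>a b. a < b \<Longrightarrow> E a b v = 0"
    using ex_highest_weight_vector[OF v0] by blast
  obtain k where "k < CARD('n)" "highest_weight_vector V (fundamental_weight k) v"
    using highest_weight_is_fundamental[OF v] by blast
  then show ?thesis
    using V irr finite_dimensional[OF irr v] unfolding is_V_delta_def by blast
qed

end

section \<open>Isomorphisms of tensor modules\<close>

lemma clinear_inv:
  assumes "clinear f" "bij f"
  shows "clinear (inv f)"
proof (rule clinearI)
  have f: "f (inv f y) = y" "inv f (f x) = x" for x y
    using assms(2) by (simp_all add: bij_is_surj surj_f_inv_f bij_is_inj)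
  show "inv f (x + y) = inv f x + inv f y" for x y
    using f(2)[of "inv f x + inv f y"] by (simp only: clinear_add[OF assms(1)] f(1))
  show "inv f (c *\<^sub>C x) = c *\<^sub>C inv f x" for c x
    using f(2)[of "c *\<^sub>C inv f x"] by (simp only: clinear_scaleC[OF assms(1)] f(1))
qed

lemma bij_tensor_lift:
  fixes \<alpha> :: "'p::complex_vector \<Rightarrow> 'q::complex_vector" and \<beta> :: "'v::complex_vector \<Rightarrow> 'w::complex_vector"
  assumes \<alpha>: "clinear \<alpha>" "bij \<alpha>" and \<beta>: "clinear \<beta>" "bij \<beta>"
  shows "cbilinear (\<lambda>z y. \<alpha> z \<otimes>\<^sub>C \<beta> y)" "bij (tensor_lift (\<lambda>z y. \<alpha> z \<otimes>\<^sub>C \<beta> y))"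
proof -
  have bil: "cbilinear (\<lambda>z y. f z \<otimes>\<^sub>C g y)" if "clinear f" "clinear g"
    for f :: "'a::complex_vector \<Rightarrow> 'b::complex_vector" and g :: "'c::complex_vector \<Rightarrow> 'd::complex_vector"
    using that unfolding cbilinear_def
    by (auto intro!: clinearI simp: clinear_add clinear_scaleC pure_tensor_add_left
        pure_tensor_add_right pure_tensor_scaleC_left pure_tensor_scaleC_right)
  let ?\<phi> = "tensor_lift (\<lambda>z y. \<alpha> z \<otimes>\<^sub>C \<beta> y)"
  let ?\<psi> = "tensor_lift (\<lambda>z y. inv \<alpha> z \<otimes>\<^sub>C inv \<beta> y)"
  note b1 = bil[OF \<alpha>(1) \<beta>(1)] and b2 = bil[OF clinear_inv[OF \<alpha>] clinear_inv[OF \<beta>]]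
  have inv: "\<alpha> (inv \<alpha> z) = z" "inv \<alpha> (\<alpha> z') = z'" "\<beta> (inv \<beta> y) = y" "inv \<beta> (\<beta> y') = y'" for z z' y y'
    using \<alpha>(2) \<beta>(2) by (simp_all add: bij_is_surj surj_f_inv_f bij_is_inj)
  show "cbilinear (\<lambda>z y. \<alpha> z \<otimes>\<^sub>C \<beta> y)" by (rule b1)
  have 1: "?\<psi> (?\<phi> t) = t" for t
    by (induction t rule: tensor_induct) (simp_all add: tensor_lift_pure b1 b2 inv
        clinear_add[OF clinear_tensor_lift[OF b1]] clinear_add[OF clinear_tensor_lift[OF b2]])
  have 2: "?\<phi> (?\<psi> t) = t" for t
    by (induction t rule: tensor_induct) (simp_all add: tensor_lift_pure b1 b2 inv
        clinear_add[OF clinear_tensor_lift[OF b1]] clinear_add[OF clinear_tensor_lift[OF b2]])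
  show "bij ?\<phi>" by (rule o_bij[of ?\<psi>]) (rule ext, simp add: 1 2)+
qed

lemma module_iso_F_action:
  assumes "tensor_modules V P" "tensor_modules V' P'"
    and "module_iso weyl_algebra P P'" "module_iso sl V V'"
  shows "module_iso div_zero (F_action P V) (F_action P' V')"
proof -
  interpret A: tensor_modules V P by fact
  interpret B: tensor_modules V' P' by fact
  obtain \<alpha> where \<alpha>: "clinear \<alpha>" "bij \<alpha>" "\<And>X z. X \<in> weyl_algebra \<Longrightarrow> \<alpha> (P X z) = P' X (\<alpha> z)"
    using assms(3) unfolding module_iso_def by blast
  obtain \<beta> where \<beta>: "clinear \<beta>" "bij \<beta>" "\<And>A y. A \<in> sl \<Longrightarrow> \<beta> (V A y) = V' A (\<beta> y)"
    using assms(4) unfolding module_iso_def by blast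
  let ?\<phi> = "tensor_lift (\<lambda>z y. \<alpha> z \<otimes>\<^sub>C \<beta> y)"
  note bil = bij_tensor_lift(1)[OF \<alpha>(1,2) \<beta>(1,2)]
  note \<phi> = clinear_tensor_lift[OF bil]
  have vf: "?\<phi> (F_action P V (vfield u r) t) = F_action P' V' (vfield u r) (?\<phi> t)"
    if ur: "pairing u r = 0" for u r t
  proof (induction t rule: tensor_induct)
    case (pure z y)
    show ?case
      by (simp only: tensor_lift_pure[OF bil] F_action_pure[OF A.P A.V ur] F_action_pure[OF B.P B.V ur]
          clinear_add[OF \<phi>] \<alpha>(3)[OF vfield_in_weyl] \<alpha>(3)[OF weyl_algebra.mult] \<beta>(3)[OF outer_in_sl[OF ur]])
  next
    case (add s t)
    then show ?case
      by (simp only: clinear_add[OF \<phi>] clinear_add[OF A.clinear_F[OF ur]] clinear_add[OF B.clinear_F[OF ur]])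
  qed
  have F: "F_action P V (X + Y) t = F_action P V X t + F_action P V Y t"
      "F_action P V (c *\<^sub>C X) t = c *\<^sub>C F_action P V X t"
      "F_action P' V' (X + Y) t' = F_action P' V' X t' + F_action P' V' Y t'"
      "F_action P' V' (c *\<^sub>C X) t' = c *\<^sub>C F_action P' V' X t'"
    if "X \<in> div_zero" "Y \<in> div_zero" for X Y c t t'
    using linear_action_F_action[OF A.P A.V] linear_action_F_action[OF B.P B.V] that
    unfolding linear_action_def by blast+
  have zero: "0 \<in> div_zero" unfolding div_zero_def by (rule complex_vector.span_zero)
  have "X \<in> div_zero \<and> (\<forall>t. ?\<phi> (F_action P V X t) = F_action P' V' X (?\<phi> t))" if "X \<in> div_zero" for X
    using that[unfolded div_zero_def]
  proof (induction rule: complex_vector.span_induct_alt)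
    case base
    have "F_action P V 0 t = 0" "F_action P' V' 0 t' = 0" for t t'
      using F(2,4)[OF zero zero, of 0] by simp_all
    then show ?case using zero clinear_0[OF \<phi>] by (simp only:) blast
  next
    case (step c X Y)
    then obtain u r where ur: "X = vfield u r" "pairing u r = 0" by blast
    then have X: "X \<in> div_zero" by (simp add: vfield_in_div_zero)
    have Y: "Y \<in> div_zero" using step by blast
    have cX: "c *\<^sub>C X \<in> div_zero"
      using X unfolding div_zero_def by (rule complex_vector.span_scale)
    have "c *\<^sub>C X + Y \<in> div_zero"
      using cX Y unfolding div_zero_def by (rule complex_vector.span_add)
    moreover have "?\<phi> (F_action P V (c *\<^sub>C X + Y) t) = F_action P' V' (c *\<^sub>C X + Y) (?\<phi> t)" for t
    proof -
      have "?\<phi> (F_action P V X t) = F_action P' V' X (?\<phi> t)"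
        "?\<phi> (F_action P V Y t) = F_action P' V' Y (?\<phi> t)"
        using step(2) vf[OF ur(2)] unfolding ur(1) by blast+
      then show ?thesis
        by (simp only: F(1,3)[OF cX Y] F(2,4)[OF X Y] clinear_add[OF \<phi>] clinear_scaleC[OF \<phi>])
    qed
    ultimately show ?case by blast
  qed
  then show ?thesis
    unfolding module_iso_def using \<phi> bij_tensor_lift(2)[OF \<alpha>(1,2) \<beta>(1,2)] by blast
qed

text \<open>
  By \<open>absorbed_square\<close>, a nonzero square of a root vector is a nonzero absorbed operator, so the
  intertwiner commutes with the actions on both factors separately.
\<close>

lemma factors_of_F_action_iso:
  fixes P :: "('n::{finite,linorder} laurent \<Rightarrow> 'n laurent) \<Rightarrow> 'p::complex_vector \<Rightarrow> 'p"
    and V :: "'n sqmatrix \<Rightarrow> 'v::complex_vector \<Rightarrow> 'v"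
  assumes mods: "tensor_modules V P" "tensor_modules V' P'"
    and irrP: "irreducible_action weyl_algebra P" "irreducible_action weyl_algebra P'"
    and irrV: "irreducible_action sl V" "irreducible_action sl V'"
    and nz: "i \<noteq> j" "V (elem_matrix i j) (V (elem_matrix i j) y) \<noteq> 0"
    and iso: "module_iso div_zero (F_action P V) (F_action P' V')"
  shows "module_iso weyl_algebra P P'" "module_iso sl V V'"
proof -
  interpret A: tensor_modules V P by fact
  interpret B: tensor_modules V' P' by fact
  obtain \<phi> where hom: "clinear \<phi>" "bij \<phi>"
    "\<And>X t. X \<in> div_zero \<Longrightarrow> \<phi> (F_action P V X t) = F_action P' V' X (\<phi> t)"
    using iso unfolding module_iso_def by blast
  interpret tensor_intertwiner P V P' V' \<phi>
    by (rule tensor_intertwiner.intro[OF mods tensor_intertwiner_axioms.intro[OF hom(1)]])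
      (rule hom(3)[OF vfield_in_div_zero])
  note intertwinesI = intertwines_if_absorbed[OF irrV(1) absorbed_square[OF nz(1)] nz(2)]
  have inj: "inj \<phi>" using hom(2) by (rule bij_is_inj)
  have lin: "linear_action weyl_algebra P" "linear_action weyl_algebra P'" "linear_action sl V"
    "linear_action sl V'"
    using A.P B.P A.V B.V by (simp_all add: operator_algebra_module_def lie_module_def)
  show "module_iso weyl_algebra P P'"
  proof (rule module_iso_left_factor[OF irrP(1) lin(1) irrP(2) lin(2) hom(1) inj])
    fix X :: "'n laurent \<Rightarrow> 'n laurent" and t assume X: "X \<in> weyl_algebra"
    have "intertwines X id id"
      using intertwinesI[OF X clinear_id clinear_id] intertwines_weyl[OF _ X] by simp
    then show "\<phi> (tensor_map (P X) id t) = tensor_map (P' X) id (\<phi> t)"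
      unfolding intertwines_def by blast
  next
    show "y \<noteq> 0"
      using nz clinear_0[OF A.clinear_V[OF elem_matrix_in_sl[OF nz(1)]]] by auto
  qed
  obtain z :: 'p where z: "z \<noteq> 0" using irrP(1) by (auto simp: irreducible_action_def)
  show "module_iso sl V V'"
  proof (rule module_iso_right_factor[OF irrV(1) lin(3) irrV(2) lin(4) hom(1) inj _ z])
    fix A :: "'n sqmatrix" and t assume A: "A \<in> sl"
    have "intertwines (xmul 0) (V A) (V' A)"
      by (rule intertwinesI[OF weyl_algebra.mult A.clinear_V[OF A] B.clinear_V[OF A]
            intertwines_weyl[OF absorbed_left[OF _ A] weyl_algebra.mult]])
    then show "\<phi> (tensor_map id (V A) t) = tensor_map id (V' A) (\<phi> t)"
      unfolding intertwines_def A.P_xmul_0 B.P_xmul_0 by blast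
  qed
qed

lemma module_iso_refl: "module_iso L act act"
  unfolding module_iso_def using clinear_id by (intro exI[of _ id]) auto

theorem proposition3p4:
  fixes P :: "('n::{finite,linorder} laurent \<Rightarrow> 'n laurent) \<Rightarrow> 'p::complex_vector \<Rightarrow> 'p"
    and P' :: "('n laurent \<Rightarrow> 'n laurent) \<Rightarrow> 'q::complex_vector \<Rightarrow> 'q"
    and V :: "'n sqmatrix \<Rightarrow> 'v::complex_vector \<Rightarrow> 'v"
    and V' :: "'n sqmatrix \<Rightarrow> 'w::complex_vector \<Rightarrow> 'w"
  assumes "CARD('n) \<ge> 2"
    and "operator_algebra_module weyl_algebra P" and "irreducible_action weyl_algebra P"
    and "operator_algebra_module weyl_algebra P'" and "irreducible_action weyl_algebra P'"
    and "lie_module sl matrix_bracket V" and "irreducible_action sl V"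
    and "lie_module sl matrix_bracket V'" and "irreducible_action sl V'"
    and "\<forall>k<CARD('n). \<forall>W :: 'n sqmatrix \<Rightarrow> 'v \<Rightarrow> 'v.
           is_V_delta k W \<longrightarrow> \<not> module_iso sl V W"
  shows "module_iso div_zero (F_action P V) (F_action P' V') \<longleftrightarrow>
    module_iso weyl_algebra P P' \<and> module_iso sl V V'"
proof -
  have mods: "tensor_modules V P" "tensor_modules V' P'"
    using assms(2,4,6,8) by (simp_all add: tensor_modules_def sl_module_def tensor_modules_axioms_def)
  have "\<exists>i j y. i \<noteq> j \<and> V (elem_matrix i j) (V (elem_matrix i j) y) \<noteq> 0"
  proof (rule ccontr)
    assume "\<not> ?thesis"
    then interpret square_zero_module V
      using assms(6) by unfold_locales auto
    obtain k where "k < CARD('n)" "is_V_delta k V" using is_V_delta[OF assms(7)] by blast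
    then show False using assms(10) module_iso_refl by blast
  qed
  then obtain i j y where nz: "i \<noteq> j" "V (elem_matrix i j) (V (elem_matrix i j) y) \<noteq> 0" by blast
  show ?thesis
    using factors_of_F_action_iso[OF mods assms(3,5,7,9) nz] module_iso_F_action[OF mods] by blast
qed

end
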